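(* Let $p:\mathbb E\to\mathbb B$ be a fibration, $\mathcal T$ a monad on $\mathbb B$, and $\dot{\mathcal T}$ a lifting of $\mathcal T$ along $p$. Then there exists a lifting parameter $R:\mathbb A\to\mathbb B_{\mathcal T}$, $S:\mathbb A\to\mathbb E$ such that $(p,S)$ satisfies the codensity condition and $\dot{\mathcal T}$ is isomorphic to the codensity lifting $\mathcal T^{\top\top}$ of $\mathcal T$ with this lifting parameter.
   Context: Notation: juxtaposition denotes whiskering, $\bullet$ vertical composition. $J\dashv K$ ($J:\mathbb B\to\mathbb B_{\mathcal T}$, $K:\mathbb B_{\mathcal T}\to\mathbb B$) is the Kleisli resolution of $\mathcal T=(T,\eta,\mu)$ with counit $\epsilon$. A lifting of $\mathcal T$ along $p$ is a monad $(\dot T,\dot\eta,\dot\mu)$ on $\mathbb E$ with $p\dot T=Tp$, $p\dot\eta=\eta p$, $p\dot\mu=\mu p$. A lifting parameter is a span $R:\mathbb A\to\mathbb B_{\mathcal T}$, $S:\mathbb A\to\mathbb E$ with $KR=pS$. $(p,S)$ satisfies the codensity condition if a right Kan extension $(\mathrm{Ran}_SS,c)$ of $S$ along $S$ exists and $p$ preserves it. The codensity monad on $\mathrm{Ran}_SS$ has unit $u$ and multiplication $m$ determined by $c\bullet uS=\mathrm{id}_S$, $c\bullet mS=c\bullet(\mathrm{Ran}_SS)c$. For $H:\mathbb E\to\mathbb B$, $\beta\mapsto pc\bullet\beta S$ is a bijection from natural transformations $H\to p\,\mathrm{Ran}_SS$ to those $HS\to pS$, with inverse $\overline{(-)}$.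 The codensity lifting $\mathcal T^{\top\top}$: $\sigma:T^{\top\top}\to\mathrm{Ran}_SS$ is a cartesian lifting of $\overline{K\epsilon R}:Tp\to p\,\mathrm{Ran}_SS$ (where $K\epsilon R:TpS=KJKR\to KR=pS$) in the fibration $[\mathbb E,p]:[\mathbb E,\mathbb E]\to[\mathbb E,\mathbb B]$; $\eta^{\top\top}$ is the unique natural transformation above $\eta p$ with $\sigma\bullet\eta^{\top\top}=u$; $\mu^{\top\top}$ is the unique one above $\mu p$ with $\sigma\bullet\mu^{\top\top}=m\bullet\sigma(\mathrm{Ran}_SS)\bullet T^{\top\top}\sigma$. *)

theory Defs
  imports Main "HOL-Library.FuncSet"
begin

section \<open>Categories\<close>

record ('o, 'm) cat =
  Obj :: "'o set"
  Arr :: "'m set"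
  Dom :: "'m \<Rightarrow> 'o"
  Cod :: "'m \<Rightarrow> 'o"
  Ident :: "'o \<Rightarrow> 'm"
  Comp :: "'m \<Rightarrow> 'm \<Rightarrow> 'm" (infixl "\<cdot>\<index>" 70)

locale category =
  fixes C :: "('o, 'm) cat" (structure)
  assumes dom_in: "f \<in> Arr C \<Longrightarrow> Dom C f \<in> Obj C"
    and cod_in: "f \<in> Arr C \<Longrightarrow> Cod C f \<in> Obj C"
    and ident_in: "X \<in> Obj C \<Longrightarrow> Ident C X \<in> Arr C"
    and ident_dom: "X \<in> Obj C \<Longrightarrow> Dom C (Ident C X) = X"
    and ident_cod: "X \<in> Obj C \<Longrightarrow> Cod C (Ident C X) = X"
    and comp_in: "\<lbrakk>f \<in> Arr C; g \<in> Arr C; Dom C g = Cod C f\<rbrakk> \<Longrightarrow> g \<cdot> f \<in> Arr C"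
    and comp_dom: "\<lbrakk>f \<in> Arr C; g \<in> Arr C; Dom C g = Cod C f\<rbrakk> \<Longrightarrow> Dom C (g \<cdot> f) = Dom C f"
    and comp_cod: "\<lbrakk>f \<in> Arr C; g \<in> Arr C; Dom C g = Cod C f\<rbrakk> \<Longrightarrow> Cod C (g \<cdot> f) = Cod C g"
    and ident_left: "f \<in> Arr C \<Longrightarrow> Ident C (Cod C f) \<cdot> f = f"
    and ident_right: "f \<in> Arr C \<Longrightarrow> f \<cdot> Ident C (Dom C f) = f"
    and comp_assoc: "\<lbrakk>f \<in> Arr C; g \<in> Arr C; h \<in> Arr C; Dom C g = Cod C f; Dom C h = Cod C g\<rbrakk>
      \<Longrightarrow> (h \<cdot> g) \<cdot> f = h \<cdot> (g \<cdot> f)"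

definition iso_arr :: "('o, 'm) cat \<Rightarrow> 'm \<Rightarrow> bool" where
  "iso_arr C f \<longleftrightarrow> f \<in> Arr C \<and>
     (\<exists>g\<in>Arr C. Dom C g = Cod C f \<and> Cod C g = Dom C f \<and>
        g \<cdot>\<^bsub>C\<^esub> f = Ident C (Dom C f) \<and> f \<cdot>\<^bsub>C\<^esub> g = Ident C (Cod C f))"


section \<open>Functors and natural transformations\<close>

text \<open>
  A functor carries its source and target category, and a natural transformation its source and
  target functor. Their maps are required to be extensional (undefined outside the carrier), so
  that equality of the records is equality of functors and of natural transformations.
\<close>

record ('o1, 'm1, 'o2, 'm2) cfunctor =
  Src :: "('o1, 'm1) cat"
  Tgt :: "('o2, 'm2) cat"
  ObM :: "'o1 \<Rightarrow> 'o2"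
  ArM :: "'m1 \<Rightarrow> 'm2"

locale is_functor =
  fixes F :: "('o1, 'm1, 'o2, 'm2) cfunctor"
  assumes src: "category (Src F)"
    and tgt: "category (Tgt F)"
    and obm: "ObM F \<in> Obj (Src F) \<rightarrow>\<^sub>E Obj (Tgt F)"
    and arm: "ArM F \<in> Arr (Src F) \<rightarrow>\<^sub>E Arr (Tgt F)"
    and pres_dom: "f \<in> Arr (Src F) \<Longrightarrow> Dom (Tgt F) (ArM F f) = ObM F (Dom (Src F) f)"
    and pres_cod: "f \<in> Arr (Src F) \<Longrightarrow> Cod (Tgt F) (ArM F f) = ObM F (Cod (Src F) f)"
    and pres_ident: "X \<in> Obj (Src F) \<Longrightarrow> ArM F (Ident (Src F) X) = Ident (Tgt F) (ObM F X)"
    and pres_comp: "\<lbrakk>f \<in> Arr (Src F); g \<in> Arr (Src F); Dom (Src F) g = Cod (Src F) f\<rbrakk>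
      \<Longrightarrow> ArM F (g \<cdot>\<^bsub>Src F\<^esub> f) = ArM F g \<cdot>\<^bsub>Tgt F\<^esub> ArM F f"

definition Fun :: "('o1, 'm1) cat \<Rightarrow> ('o2, 'm2) cat \<Rightarrow> ('o1, 'm1, 'o2, 'm2) cfunctor set" where
  "Fun A B = {F. is_functor F \<and> Src F = A \<and> Tgt F = B}"

definition id_functor :: "('o, 'm) cat \<Rightarrow> ('o, 'm, 'o, 'm) cfunctor" where
  "id_functor C = \<lparr>Src = C, Tgt = C, ObM = (\<lambda>X\<in>Obj C. X), ArM = (\<lambda>f\<in>Arr C. f)\<rparr>"

definition fcomp ::
  "('o2, 'm2, 'o3, 'm3) cfunctor \<Rightarrow> ('o1, 'm1, 'o2, 'm2) cfunctor \<Rightarrow> ('o1, 'm1, 'o3, 'm3) cfunctor"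
  (infixl "\<circ>\<^sub>F" 75) where
  "G \<circ>\<^sub>F F = \<lparr>Src = Src F, Tgt = Tgt G,
     ObM = (\<lambda>X\<in>Obj (Src F). ObM G (ObM F X)),
     ArM = (\<lambda>f\<in>Arr (Src F). ArM G (ArM F f))\<rparr>"

record ('o1, 'm1, 'o2, 'm2) nat_tr =
  NSrc :: "('o1, 'm1, 'o2, 'm2) cfunctor"
  NTgt :: "('o1, 'm1, 'o2, 'm2) cfunctor"
  At :: "'o1 \<Rightarrow> 'm2"

locale is_nat_tr =
  fixes \<tau> :: "('o1, 'm1, 'o2, 'm2) nat_tr"
  assumes nsrc: "is_functor (NSrc \<tau>)"
    and ntgt: "is_functor (NTgt \<tau>)"
    and same_src: "Src (NTgt \<tau>) = Src (NSrc \<tau>)"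
    and same_tgt: "Tgt (NTgt \<tau>) = Tgt (NSrc \<tau>)"
    and at_in: "At \<tau> \<in> Obj (Src (NSrc \<tau>)) \<rightarrow>\<^sub>E Arr (Tgt (NSrc \<tau>))"
    and at_dom: "X \<in> Obj (Src (NSrc \<tau>)) \<Longrightarrow> Dom (Tgt (NSrc \<tau>)) (At \<tau> X) = ObM (NSrc \<tau>) X"
    and at_cod: "X \<in> Obj (Src (NSrc \<tau>)) \<Longrightarrow> Cod (Tgt (NSrc \<tau>)) (At \<tau> X) = ObM (NTgt \<tau>) X"
    and naturality: "f \<in> Arr (Src (NSrc \<tau>)) \<Longrightarrow>
      At \<tau> (Cod (Src (NSrc \<tau>)) f) \<cdot>\<^bsub>Tgt (NSrc \<tau>)\<^esub> ArM (NSrc \<tau>) f =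
      ArM (NTgt \<tau>) f \<cdot>\<^bsub>Tgt (NSrc \<tau>)\<^esub> At \<tau> (Dom (Src (NSrc \<tau>)) f)"

definition Nat ::
  "('o1, 'm1, 'o2, 'm2) cfunctor \<Rightarrow> ('o1, 'm1, 'o2, 'm2) cfunctor \<Rightarrow> ('o1, 'm1, 'o2, 'm2) nat_tr set"
  where
  "Nat F G = {\<tau>. is_nat_tr \<tau> \<and> NSrc \<tau> = F \<and> NTgt \<tau> = G}"

definition id_nat :: "('o1, 'm1, 'o2, 'm2) cfunctor \<Rightarrow> ('o1, 'm1, 'o2, 'm2) nat_tr" where
  "id_nat F = \<lparr>NSrc = F, NTgt = F, At = (\<lambda>X\<in>Obj (Src F). Ident (Tgt F) (ObM F X))\<rparr>"

definition vcomp ::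
  "('o1, 'm1, 'o2, 'm2) nat_tr \<Rightarrow> ('o1, 'm1, 'o2, 'm2) nat_tr \<Rightarrow> ('o1, 'm1, 'o2, 'm2) nat_tr"
  (infixl "\<bullet>" 65) where
  "\<beta> \<bullet> \<alpha> = \<lparr>NSrc = NSrc \<alpha>, NTgt = NTgt \<beta>,
     At = (\<lambda>X\<in>Obj (Src (NSrc \<alpha>)). At \<beta> X \<cdot>\<^bsub>Tgt (NSrc \<alpha>)\<^esub> At \<alpha> X)\<rparr>"

text \<open>The whiskerings \<open>F \<triangleright> \<tau>\<close> and \<open>\<tau> \<triangleleft> F\<close> are written \<open>F\<tau>\<close> and \<open>\<tau>F\<close> by juxtaposition in the literature.\<close>

definition whisker_left ::
  "('o2, 'm2, 'o3, 'm3) cfunctor \<Rightarrow> ('o1, 'm1, 'o2, 'm2) nat_tr \<Rightarrow> ('o1, 'm1, 'o3, 'm3) nat_tr"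
  (infixr "\<triangleright>" 72) where
  "F \<triangleright> \<tau> = \<lparr>NSrc = F \<circ>\<^sub>F NSrc \<tau>, NTgt = F \<circ>\<^sub>F NTgt \<tau>,
     At = (\<lambda>X\<in>Obj (Src (NSrc \<tau>)). ArM F (At \<tau> X))\<rparr>"

definition whisker_right ::
  "('o2, 'm2, 'o3, 'm3) nat_tr \<Rightarrow> ('o1, 'm1, 'o2, 'm2) cfunctor \<Rightarrow> ('o1, 'm1, 'o3, 'm3) nat_tr"
  (infixl "\<triangleleft>" 73) where
  "\<tau> \<triangleleft> F = \<lparr>NSrc = NSrc \<tau> \<circ>\<^sub>F F, NTgt = NTgt \<tau> \<circ>\<^sub>F F,
     At = (\<lambda>X\<in>Obj (Src F). At \<tau> (ObM F X))\<rparr>"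

definition functor_category ::
  "('o1, 'm1) cat \<Rightarrow> ('o2, 'm2) cat \<Rightarrow>
     (('o1, 'm1, 'o2, 'm2) cfunctor, ('o1, 'm1, 'o2, 'm2) nat_tr) cat" where
  "functor_category A B = \<lparr>Obj = Fun A B,
     Arr = {\<tau>. is_nat_tr \<tau> \<and> NSrc \<tau> \<in> Fun A B \<and> NTgt \<tau> \<in> Fun A B},
     Dom = NSrc, Cod = NTgt, Ident = id_nat, Comp = vcomp\<rparr>"

text \<open>The functor \<open>[A, F] : [A, B] \<rightarrow> [A, C]\<close> for \<open>F : B \<rightarrow> C\<close>.\<close>
definition postcomp_functor ::
  "('o1, 'm1) cat \<Rightarrow> ('o2, 'm2, 'o3, 'm3) cfunctor \<Rightarrow>
     (('o1, 'm1, 'o2, 'm2) cfunctor, ('o1, 'm1, 'o2, 'm2) nat_tr,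
      ('o1, 'm1, 'o3, 'm3) cfunctor, ('o1, 'm1, 'o3, 'm3) nat_tr) cfunctor" where
  "postcomp_functor A F =
     \<lparr>Src = functor_category A (Src F), Tgt = functor_category A (Tgt F),
      ObM = (\<lambda>H\<in>Obj (functor_category A (Src F)). F \<circ>\<^sub>F H),
      ArM = (\<lambda>\<tau>\<in>Arr (functor_category A (Src F)). F \<triangleright> \<tau>)\<rparr>"


section \<open>Fibrations\<close>

definition cartesian :: "('o1, 'm1, 'o2, 'm2) cfunctor \<Rightarrow> 'm1 \<Rightarrow> bool" where
  "cartesian p f \<longleftrightarrow> f \<in> Arr (Src p) \<and>
     (\<forall>g\<in>Arr (Src p). \<forall>h\<in>Arr (Tgt p).
        Cod (Src p) g = Cod (Src p) f \<and>
        Dom (Tgt p) h = ObM p (Dom (Src p) g) \<and>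
        Cod (Tgt p) h = ObM p (Dom (Src p) f) \<and>
        ArM p f \<cdot>\<^bsub>Tgt p\<^esub> h = ArM p g \<longrightarrow>
        (\<exists>!k. k \<in> Arr (Src p) \<and> Dom (Src p) k = Dom (Src p) g \<and> Cod (Src p) k = Dom (Src p) f \<and>
              ArM p k = h \<and> f \<cdot>\<^bsub>Src p\<^esub> k = g))"

definition cartesian_lifting :: "('o1, 'm1, 'o2, 'm2) cfunctor \<Rightarrow> 'm2 \<Rightarrow> 'o1 \<Rightarrow> 'm1 \<Rightarrow> bool" where
  "cartesian_lifting p u Y f \<longleftrightarrow> cartesian p f \<and> Cod (Src p) f = Y \<and> ArM p f = u"

definition fibration :: "('o1, 'm1, 'o2, 'm2) cfunctor \<Rightarrow> bool" where
  "fibration p \<longleftrightarrow> is_functor p \<and>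
     (\<forall>Y\<in>Obj (Src p). \<forall>u\<in>Arr (Tgt p). Cod (Tgt p) u = ObM p Y \<longrightarrow> (\<exists>f. cartesian_lifting p u Y f))"


section \<open>Monads, Kleisli resolutions and liftings\<close>

record ('o, 'm) mnd =
  MFun :: "('o, 'm, 'o, 'm) cfunctor"
  Unit :: "('o, 'm, 'o, 'm) nat_tr"
  Mult :: "('o, 'm, 'o, 'm) nat_tr"

definition monad_on :: "('o, 'm) cat \<Rightarrow> ('o, 'm) mnd \<Rightarrow> bool" where
  "monad_on C T \<longleftrightarrow>
     MFun T \<in> Fun C C \<and>
     Unit T \<in> Nat (id_functor C) (MFun T) \<and>
     Mult T \<in> Nat (MFun T \<circ>\<^sub>F MFun T) (MFun T) \<and>
     Mult T \<bullet> Unit T \<triangleleft> MFun T = id_nat (MFun T) \<and>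
     Mult T \<bullet> MFun T \<triangleright> Unit T = id_nat (MFun T) \<and>
     Mult T \<bullet> Mult T \<triangleleft> MFun T = Mult T \<bullet> MFun T \<triangleright> Mult T"

text \<open>
  An arrow \<open>X \<rightarrow> Y\<close> of the Kleisli category is a pair \<open>(f, Y)\<close> with \<open>f : X \<rightarrow> T Y\<close>; the component \<open>Y\<close>
  is recorded since it is not determined by \<open>f\<close>.
\<close>

definition kleisli :: "('o, 'm) mnd \<Rightarrow> ('o, 'm \<times> 'o) cat" where
  "kleisli T = (let C = Src (MFun T) in
     \<lparr>Obj = Obj C,
      Arr = {(f, Y). f \<in> Arr C \<and> Y \<in> Obj C \<and> Cod C f = ObM (MFun T) Y},
      Dom = (\<lambda>(f, Y). Dom C f),
      Cod = snd,
      Ident = (\<lambda>X. (At (Unit T) X, X)),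
      Comp = (\<lambda>(g, Z) (f, Y). (At (Mult T) Z \<cdot>\<^bsub>C\<^esub> (ArM (MFun T) g \<cdot>\<^bsub>C\<^esub> f), Z))\<rparr>)"

definition kleisli_J :: "('o, 'm) mnd \<Rightarrow> ('o, 'm, 'o, 'm \<times> 'o) cfunctor" where
  "kleisli_J T = (let C = Src (MFun T) in
     \<lparr>Src = C, Tgt = kleisli T,
      ObM = (\<lambda>X\<in>Obj C. X),
      ArM = (\<lambda>f\<in>Arr C. (At (Unit T) (Cod C f) \<cdot>\<^bsub>C\<^esub> f, Cod C f))\<rparr>)"

definition kleisli_K :: "('o, 'm) mnd \<Rightarrow> ('o, 'm \<times> 'o, 'o, 'm) cfunctor" where
  "kleisli_K T = (let C = Src (MFun T) in
     \<lparr>Src = kleisli T, Tgt = C,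
      ObM = (\<lambda>X\<in>Obj (kleisli T). ObM (MFun T) X),
      ArM = (\<lambda>(f, Y)\<in>Arr (kleisli T). At (Mult T) Y \<cdot>\<^bsub>C\<^esub> ArM (MFun T) f)\<rparr>)"

text \<open>The counit \<open>\<epsilon> : J K \<rightarrow> Id\<close>; its component at \<open>X\<close> is the identity of \<open>T X\<close>, read as a Kleisli arrow
  \<open>T X \<rightarrow> X\<close>.\<close>
definition kleisli_counit :: "('o, 'm) mnd \<Rightarrow> ('o, 'm \<times> 'o, 'o, 'm \<times> 'o) nat_tr" where
  "kleisli_counit T =
     \<lparr>NSrc = kleisli_J T \<circ>\<^sub>F kleisli_K T, NTgt = id_functor (kleisli T),
      At = (\<lambda>X\<in>Obj (kleisli T). (Ident (Src (MFun T)) (ObM (MFun T) X), X))\<rparr>"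

definition monad_lifting ::
  "('oe, 'me, 'ob, 'mb) cfunctor \<Rightarrow> ('ob, 'mb) mnd \<Rightarrow> ('oe, 'me) mnd \<Rightarrow> bool" where
  "monad_lifting p T L \<longleftrightarrow> monad_on (Src p) L \<and>
     p \<circ>\<^sub>F MFun L = MFun T \<circ>\<^sub>F p \<and>
     p \<triangleright> Unit L = Unit T \<triangleleft> p \<and>
     p \<triangleright> Mult L = Mult T \<triangleleft> p"

text \<open>An isomorphism of liftings is an isomorphism of monads that is vertical, i.e. lies above the
  identity on \<open>T p\<close>.\<close>
definition iso_liftings ::
  "('oe, 'me, 'ob, 'mb) cfunctor \<Rightarrow> ('ob, 'mb) mnd \<Rightarrow> ('oe, 'me) mnd \<Rightarrow> ('oe, 'me) mnd \<Rightarrow> bool" where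
  "iso_liftings p T L L' \<longleftrightarrow> monad_lifting p T L \<and> monad_lifting p T L' \<and>
     (\<exists>\<phi> \<in> Nat (MFun L) (MFun L').
        iso_arr (functor_category (Src p) (Src p)) \<phi> \<and>
        p \<triangleright> \<phi> = id_nat (MFun T \<circ>\<^sub>F p) \<and>
        \<phi> \<bullet> Unit L = Unit L' \<and>
        \<phi> \<bullet> Mult L = Mult L' \<bullet> \<phi> \<triangleleft> MFun L' \<bullet> MFun L \<triangleright> \<phi>)"


section \<open>Right Kan extensions and codensity liftings\<close>

text \<open>\<open>(R, c)\<close> is a right Kan extension of \<open>F : A \<rightarrow> C\<close> along \<open>G : A \<rightarrow> D\<close>.\<close>
definition is_ran ::
  "('oa, 'ma, 'od, 'md) cfunctor \<Rightarrow> ('oa, 'ma, 'oc, 'mc) cfunctor \<Rightarrow>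
   ('od, 'md, 'oc, 'mc) cfunctor \<Rightarrow> ('oa, 'ma, 'oc, 'mc) nat_tr \<Rightarrow> bool" where
  "is_ran G F R c \<longleftrightarrow> is_functor G \<and> is_functor F \<and> Src F = Src G \<and>
     R \<in> Fun (Tgt G) (Tgt F) \<and> c \<in> Nat (R \<circ>\<^sub>F G) F \<and>
     (\<forall>H \<in> Fun (Tgt G) (Tgt F). \<forall>\<alpha> \<in> Nat (H \<circ>\<^sub>F G) F. \<exists>!\<beta>. \<beta> \<in> Nat H R \<and> c \<bullet> \<beta> \<triangleleft> G = \<alpha>)"

definition preserves_ran ::
  "('oc, 'mc, 'ox, 'mx) cfunctor \<Rightarrow> ('oa, 'ma, 'od, 'md) cfunctor \<Rightarrow> ('oa, 'ma, 'oc, 'mc) cfunctor \<Rightarrow>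
   ('od, 'md, 'oc, 'mc) cfunctor \<Rightarrow> ('oa, 'ma, 'oc, 'mc) nat_tr \<Rightarrow> bool" where
  "preserves_ran p G F R c \<longleftrightarrow> is_ran G (p \<circ>\<^sub>F F) (p \<circ>\<^sub>F R) (p \<triangleright> c)"

definition codensity_condition ::
  "('oe, 'me, 'ob, 'mb) cfunctor \<Rightarrow> ('oa, 'ma, 'oe, 'me) cfunctor \<Rightarrow> bool" where
  "codensity_condition p S \<longleftrightarrow> (\<exists>Ran c. is_ran S S Ran c \<and> preserves_ran p S S Ran c)"

definition lifting_parameter ::
  "('oe, 'me, 'ob, 'mb) cfunctor \<Rightarrow> ('ob, 'mb) mnd \<Rightarrow> ('oa, 'ma) cat \<Rightarrow>
   ('oa, 'ma, 'ob, 'mb \<times> 'ob) cfunctor \<Rightarrow> ('oa, 'ma, 'oe, 'me) cfunctor \<Rightarrow> bool" where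
  "lifting_parameter p T A R S \<longleftrightarrow> R \<in> Fun A (kleisli T) \<and> S \<in> Fun A (Src p) \<and>
     kleisli_K T \<circ>\<^sub>F R = p \<circ>\<^sub>F S"

text \<open>The descriptions in the next three definitions are unique by the universal properties of
  \<open>(Ran, c)\<close> and \<open>(p Ran, p c)\<close>, whenever \<open>(Ran, c)\<close> is a right Kan extension of \<open>S\<close> along \<open>S\<close>
  preserved by \<open>p\<close>.\<close>

definition codensity_unit ::
  "('oa, 'ma, 'oe, 'me) cfunctor \<Rightarrow> ('oe, 'me, 'oe, 'me) cfunctor \<Rightarrow> ('oa, 'ma, 'oe, 'me) nat_tr \<Rightarrow>
   ('oe, 'me, 'oe, 'me) nat_tr" where
  "codensity_unit S Ran c =
     (THE u. u \<in> Nat (id_functor (Tgt S)) Ran \<and> c \<bullet> u \<triangleleft> S = id_nat S)"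

definition codensity_mult ::
  "('oa, 'ma, 'oe, 'me) cfunctor \<Rightarrow> ('oe, 'me, 'oe, 'me) cfunctor \<Rightarrow> ('oa, 'ma, 'oe, 'me) nat_tr \<Rightarrow>
   ('oe, 'me, 'oe, 'me) nat_tr" where
  "codensity_mult S Ran c =
     (THE m. m \<in> Nat (Ran \<circ>\<^sub>F Ran) Ran \<and> c \<bullet> m \<triangleleft> S = c \<bullet> Ran \<triangleright> c)"

definition ran_transpose ::
  "('oe, 'me, 'ob, 'mb) cfunctor \<Rightarrow> ('oa, 'ma, 'oe, 'me) cfunctor \<Rightarrow> ('oe, 'me, 'oe, 'me) cfunctor \<Rightarrow>
   ('oa, 'ma, 'oe, 'me) nat_tr \<Rightarrow> ('oe, 'me, 'ob, 'mb) cfunctor \<Rightarrow> ('oa, 'ma, 'ob, 'mb) nat_tr \<Rightarrow>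
   ('oe, 'me, 'ob, 'mb) nat_tr" where
  "ran_transpose p S Ran c H \<alpha> =
     (THE \<beta>. \<beta> \<in> Nat H (p \<circ>\<^sub>F Ran) \<and> p \<triangleright> c \<bullet> \<beta> \<triangleleft> S = \<alpha>)"

text \<open>The codensity lifting depends on the choice of the Kan extension and of the cartesian lifting
  \<open>\<sigma>\<close>. The following predicate says that \<open>L\<close> is a codensity lifting of \<open>T\<close> for some such choice;
  its unit and multiplication are then determined, as \<open>\<sigma>\<close> is cartesian.\<close>
definition codensity_lifting ::
  "('oe, 'me, 'ob, 'mb) cfunctor \<Rightarrow> ('ob, 'mb) mnd \<Rightarrow> ('oa, 'ma, 'ob, 'mb \<times> 'ob) cfunctor \<Rightarrow>
   ('oa, 'ma, 'oe, 'me) cfunctor \<Rightarrow> ('oe, 'me) mnd \<Rightarrow> bool" where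
  "codensity_lifting p T R S L \<longleftrightarrow>
     (\<exists>Ran c \<sigma>. is_ran S S Ran c \<and> preserves_ran p S S Ran c \<and>
        \<sigma> \<in> Nat (MFun L) Ran \<and>
        cartesian_lifting (postcomp_functor (Src p) p)
          (ran_transpose p S Ran c (MFun T \<circ>\<^sub>F p) (kleisli_K T \<triangleright> kleisli_counit T \<triangleleft> R)) Ran \<sigma> \<and>
        Unit L \<in> Nat (id_functor (Src p)) (MFun L) \<and>
        p \<triangleright> Unit L = Unit T \<triangleleft> p \<and>
        \<sigma> \<bullet> Unit L = codensity_unit S Ran c \<and>
        Mult L \<in> Nat (MFun L \<circ>\<^sub>F MFun L) (MFun L) \<and>
        p \<triangleright> Mult L = Mult T \<triangleleft> p \<and>
        \<sigma> \<bullet> Mult L = codensity_mult S Ran c \<bullet> \<sigma> \<triangleleft> Ran \<bullet> MFun L \<triangleright> \<sigma>)"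

end

theory Submission
  imports Defs
begin

text \<open>
  Take for \<open>S\<close> the right adjoint \<open>K\<close> of the Kleisli resolution \<open>J \<stileturn> K\<close> of the lifted monad \<open>D\<close>, and
  for \<open>R\<close> the functor that \<open>p\<close> induces between the Kleisli categories. A right Kan extension along a
  right adjoint is precomposition with the left adjoint; hence it is preserved by every functor, and
  \<open>Ran\<^sub>S S = K J = D\<close>, with codensity monad \<open>D\<close> itself. The transpose of \<open>K\<epsilon>R = pK\<epsilon>\<close> is then the
  identity, so \<open>D\<close> with \<open>\<sigma> = id\<close> is a codensity lifting. For any other choice of Kan extension and of
  \<open>\<sigma>\<close>, the comparison isomorphism \<open>\<theta>\<close> of Kan extensions factors through the cartesian \<open>\<sigma>\<close> as
  \<open>\<theta> = \<sigma> \<bullet> \<phi>\<close> with \<open>\<phi>\<close> vertical, and \<open>\<phi>\<close> is the required isomorphism of liftings.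
\<close>

section \<open>Functors and natural transformations\<close>

text \<open>A codensity lifting is fixed only up to choices, and \<open>codensity_lifting\<close>
  does not itself demand the monad laws of \<open>L\<close>: it pins down unit and multiplication by
  their images under \<open>p\<close> and their composites with \<sigma>. Hence the comparison
  \<phi> must first be shown invertible and compatible with unit and multiplication; only then are
  the laws of \<open>L\<close> inherited from \<open>D\<close>. All choices of Kan extension enter
  through the one comparison \<theta>, so the transpose, the codensity unit and the codensity
  multiplication are described once in terms of \<theta>. Taking the identity for \<theta> then
  yields that \<open>D\<close> is a codensity lifting, and a general \<theta> yields the
  isomorphism. That the codensity monad of \<open>K\<close> is \<open>D\<close> comes down to
  \<open>K \<epsilon>\<close> having the multiplication of \<open>D\<close> as its
  components.\<close>

lemma FunD:
  assumes "F \<in> Fun A B"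
  shows "is_functor F" "category A" "category B" "Src F = A" "Tgt F = B"
    and "X \<in> Obj A \<Longrightarrow> ObM F X \<in> Obj B"
    and "f \<in> Arr A \<Longrightarrow> ArM F f \<in> Arr B"
    and "f \<in> Arr A \<Longrightarrow> Dom B (ArM F f) = ObM F (Dom A f)"
    and "f \<in> Arr A \<Longrightarrow> Cod B (ArM F f) = ObM F (Cod A f)"
    and "X \<in> Obj A \<Longrightarrow> ArM F (Ident A X) = Ident B (ObM F X)"
    and "\<lbrakk>f \<in> Arr A; g \<in> Arr A; Dom A g = Cod A f\<rbrakk> \<Longrightarrow> ArM F (g \<cdot>\<^bsub>A\<^esub> f) = ArM F g \<cdot>\<^bsub>B\<^esub> ArM F f"
proof -
  from assms have *: "is_functor F" "Src F = A" "Tgt F = B" by (auto simp: Fun_def)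
  interpret is_functor F by fact
  show "is_functor F" "category A" "category B" "Src F = A" "Tgt F = B"
    and "X \<in> Obj A \<Longrightarrow> ObM F X \<in> Obj B"
    and "f \<in> Arr A \<Longrightarrow> ArM F f \<in> Arr B"
    and "f \<in> Arr A \<Longrightarrow> Dom B (ArM F f) = ObM F (Dom A f)"
    and "f \<in> Arr A \<Longrightarrow> Cod B (ArM F f) = ObM F (Cod A f)"
    and "X \<in> Obj A \<Longrightarrow> ArM F (Ident A X) = Ident B (ObM F X)"
    and "\<lbrakk>f \<in> Arr A; g \<in> Arr A; Dom A g = Cod A f\<rbrakk> \<Longrightarrow> ArM F (g \<cdot>\<^bsub>A\<^esub> f) = ArM F g \<cdot>\<^bsub>B\<^esub> ArM F f"
    using * src tgt obm arm pres_dom pres_cod pres_ident pres_comp by auto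
qed

lemma Fun_extensional:
  assumes "F \<in> Fun A B"
  shows "ObM F \<in> extensional (Obj A)" "ArM F \<in> extensional (Arr A)"
  using assms is_functor.obm[of F] is_functor.arm[of F] by (auto simp: Fun_def PiE_def)

text \<open>The maps are extensional and the record stores both categories, so agreement on the
  carriers leaves no room for the records to differ.\<close>

lemma Fun_eqI:
  assumes "F \<in> Fun A B" "G \<in> Fun A B"
    and "\<And>X. X \<in> Obj A \<Longrightarrow> ObM F X = ObM G X"
    and "\<And>f. f \<in> Arr A \<Longrightarrow> ArM F f = ArM G f"
  shows "F = G"
proof -
  have "ObM F = ObM G" "ArM F = ArM G"
    using Fun_extensional[OF assms(1)] Fun_extensional[OF assms(2)] assms(3,4)
    by (auto intro: extensionalityI)
  then show ?thesis using FunD(4,5)[OF assms(1)] FunD(4,5)[OF assms(2)] by (cases F, cases G) simp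
qed

lemma NatD:
  assumes "\<tau> \<in> Nat F G" "F \<in> Fun A B"
  shows "G \<in> Fun A B" "NSrc \<tau> = F" "NTgt \<tau> = G" "At \<tau> \<in> extensional (Obj A)"
    and "X \<in> Obj A \<Longrightarrow> At \<tau> X \<in> Arr B"
    and "X \<in> Obj A \<Longrightarrow> Dom B (At \<tau> X) = ObM F X"
    and "X \<in> Obj A \<Longrightarrow> Cod B (At \<tau> X) = ObM G X"
proof -
  from assms have *: "is_nat_tr \<tau>" "NSrc \<tau> = F" "NTgt \<tau> = G" "Src F = A" "Tgt F = B"
    by (auto simp: Nat_def Fun_def)
  interpret is_nat_tr \<tau> by fact
  show "G \<in> Fun A B" "NSrc \<tau> = F" "NTgt \<tau> = G" "At \<tau> \<in> extensional (Obj A)"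
    and "X \<in> Obj A \<Longrightarrow> At \<tau> X \<in> Arr B"
    and "X \<in> Obj A \<Longrightarrow> Dom B (At \<tau> X) = ObM F X"
    and "X \<in> Obj A \<Longrightarrow> Cod B (At \<tau> X) = ObM G X"
    using * ntgt same_src same_tgt at_in at_dom at_cod by (auto simp: Fun_def PiE_def)
qed

lemma Nat_naturality:
  assumes "\<tau> \<in> Nat F G" "F \<in> Fun A B" "f \<in> Arr A"
  shows "At \<tau> (Cod A f) \<cdot>\<^bsub>B\<^esub> ArM F f = ArM G f \<cdot>\<^bsub>B\<^esub> At \<tau> (Dom A f)"
  using assms is_nat_tr.naturality[of \<tau> f] by (auto simp: Nat_def Fun_def)

lemma NatI:
  assumes "F \<in> Fun A B" "G \<in> Fun A B" "NSrc \<tau> = F" "NTgt \<tau> = G" "At \<tau> \<in> extensional (Obj A)"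
    and "\<And>X. X \<in> Obj A \<Longrightarrow> At \<tau> X \<in> Arr B \<and> Dom B (At \<tau> X) = ObM F X \<and> Cod B (At \<tau> X) = ObM G X"
    and "\<And>f. f \<in> Arr A \<Longrightarrow> At \<tau> (Cod A f) \<cdot>\<^bsub>B\<^esub> ArM F f = ArM G f \<cdot>\<^bsub>B\<^esub> At \<tau> (Dom A f)"
  shows "\<tau> \<in> Nat F G"
  using assms by (auto simp: Nat_def Fun_def is_nat_tr_def PiE_def)

lemma Nat_eqI:
  assumes "\<sigma> \<in> Nat F G" "\<tau> \<in> Nat F G" "F \<in> Fun A B"
    and "\<And>X. X \<in> Obj A \<Longrightarrow> At \<sigma> X = At \<tau> X"
  shows "\<sigma> = \<tau>"
proof -
  have "At \<sigma> = At \<tau>"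
    using NatD(4)[OF assms(1,3)] NatD(4)[OF assms(2,3)] assms(4) by (auto intro: extensionalityI)
  then show ?thesis
    using NatD(2,3)[OF assms(1,3)] NatD(2,3)[OF assms(2,3)] by (cases \<sigma>, cases \<tau>) simp
qed

lemma id_functor_sel [simp]:
  "Src (id_functor C) = C" "Tgt (id_functor C) = C"
  "X \<in> Obj C \<Longrightarrow> ObM (id_functor C) X = X" "f \<in> Arr C \<Longrightarrow> ArM (id_functor C) f = f"
  by (simp_all add: id_functor_def)

lemma fcomp_sel [simp]:
  "Src (G \<circ>\<^sub>F F) = Src F" "Tgt (G \<circ>\<^sub>F F) = Tgt G"
  "X \<in> Obj (Src F) \<Longrightarrow> ObM (G \<circ>\<^sub>F F) X = ObM G (ObM F X)"
  "f \<in> Arr (Src F) \<Longrightarrow> ArM (G \<circ>\<^sub>F F) f = ArM G (ArM F f)"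
  by (simp_all add: fcomp_def)

lemma id_nat_sel [simp]:
  "NSrc (id_nat F) = F" "NTgt (id_nat F) = F"
  "X \<in> Obj (Src F) \<Longrightarrow> At (id_nat F) X = Ident (Tgt F) (ObM F X)"
  by (simp_all add: id_nat_def)

lemma vcomp_sel [simp]:
  "NSrc (\<beta> \<bullet> \<alpha>) = NSrc \<alpha>" "NTgt (\<beta> \<bullet> \<alpha>) = NTgt \<beta>"
  "X \<in> Obj (Src (NSrc \<alpha>)) \<Longrightarrow> At (\<beta> \<bullet> \<alpha>) X = At \<beta> X \<cdot>\<^bsub>Tgt (NSrc \<alpha>)\<^esub> At \<alpha> X"
  by (simp_all add: vcomp_def)

lemma whisker_left_sel [simp]:
  "NSrc (F \<triangleright> \<tau>) = F \<circ>\<^sub>F NSrc \<tau>" "NTgt (F \<triangleright> \<tau>) = F \<circ>\<^sub>F NTgt \<tau>"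
  "X \<in> Obj (Src (NSrc \<tau>)) \<Longrightarrow> At (F \<triangleright> \<tau>) X = ArM F (At \<tau> X)"
  by (simp_all add: whisker_left_def)

lemma whisker_right_sel [simp]:
  "NSrc (\<tau> \<triangleleft> F) = NSrc \<tau> \<circ>\<^sub>F F" "NTgt (\<tau> \<triangleleft> F) = NTgt \<tau> \<circ>\<^sub>F F"
  "X \<in> Obj (Src F) \<Longrightarrow> At (\<tau> \<triangleleft> F) X = At \<tau> (ObM F X)"
  by (simp_all add: whisker_right_def)

section \<open>Composition of functors; vertical composition and whiskering of natural
  transformations\<close>

lemma id_functor_Fun:
  assumes "category C"
  shows "id_functor C \<in> Fun C C"
proof -
  interpret category C by fact
  show ?thesis
    by (simp add: Fun_def is_functor_def assms id_functor_def dom_in cod_in ident_in comp_in)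
qed

lemma fcomp_Fun:
  assumes "F \<in> Fun A B" "G \<in> Fun B C"
  shows "G \<circ>\<^sub>F F \<in> Fun A C"
proof -
  interpret A: category A by (rule FunD(2)[OF assms(1)])
  show ?thesis
    by (auto simp add: Fun_def is_functor_def fcomp_def FunD[OF assms(1)] FunD[OF assms(2)]
      A.dom_in A.cod_in A.ident_in A.comp_in)
qed

text \<open>Associativity is strict, an equality of records. This matters because a natural
  transformation stores its source and target functors: whiskered composites fit together only after
  their endpoints are rewritten by such equations.\<close>

lemma fcomp_assoc:
  assumes "F \<in> Fun A B" "G \<in> Fun B C"
  shows "H \<circ>\<^sub>F (G \<circ>\<^sub>F F) = H \<circ>\<^sub>F G \<circ>\<^sub>F F"
  by (auto simp add: fcomp_def FunD[OF assms(1)] FunD[OF assms(2)] intro!: restrict_ext)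

lemma fcomp_id_left:
  assumes "F \<in> Fun A B"
  shows "id_functor B \<circ>\<^sub>F F = F"
  by (rule Fun_eqI[OF fcomp_Fun[OF assms id_functor_Fun] assms])
    (simp_all add: FunD[OF assms])

lemma fcomp_id_right:
  assumes "F \<in> Fun A B"
  shows "F \<circ>\<^sub>F id_functor A = F"
  by (rule Fun_eqI[OF fcomp_Fun[OF id_functor_Fun assms] assms])
    (simp_all add: FunD[OF assms])

lemma id_nat_Nat:
  assumes "F \<in> Fun A B"
  shows "id_nat F \<in> Nat F F"
proof -
  interpret A: category A by (rule FunD(2)[OF assms])
  interpret B: category B by (rule FunD(3)[OF assms])
  note F = FunD[OF assms]
  show ?thesis
  proof (rule NatI[OF assms assms])
    fix f assume f: "f \<in> Arr A"
    show "At (id_nat F) (Cod A f) \<cdot>\<^bsub>B\<^esub> ArM F f = ArM F f \<cdot>\<^bsub>B\<^esub> At (id_nat F) (Dom A f)"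
      using B.ident_left[of "ArM F f"] B.ident_right[of "ArM F f"] f
      by (simp add: F A.cod_in A.dom_in)
  qed (simp_all add: F B.ident_in B.ident_dom B.ident_cod, simp add: id_nat_def F)
qed

lemma vcomp_Nat:
  assumes "\<alpha> \<in> Nat F G" "\<beta> \<in> Nat G H" "F \<in> Fun A B"
  shows "\<beta> \<bullet> \<alpha> \<in> Nat F H"
proof -
  note a = NatD[OF assms(1,3)]
  note b = NatD[OF assms(2) a(1)]
  note F = FunD[OF assms(3)] and G = FunD[OF a(1)] and H = FunD[OF b(1)]
  interpret A: category A by (rule F)
  interpret B: category B by (rule F)
  show ?thesis
  proof (rule NatI[OF assms(3) b(1)])
    fix f assume f: "f \<in> Arr A"
    have "At \<beta> (Cod A f) \<cdot>\<^bsub>B\<^esub> (At \<alpha> (Cod A f) \<cdot>\<^bsub>B\<^esub> ArM F f) = 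
      (At \<beta> (Cod A f) \<cdot>\<^bsub>B\<^esub> ArM G f) \<cdot>\<^bsub>B\<^esub> At \<alpha> (Dom A f)"
      using f by (simp add: Nat_naturality[OF assms(1,3) f] B.comp_assoc F G a b A.cod_in A.dom_in)
    also have "\<dots> = ArM H f \<cdot>\<^bsub>B\<^esub> (At \<beta> (Dom A f) \<cdot>\<^bsub>B\<^esub> At \<alpha> (Dom A f))"
      using f by (simp add: Nat_naturality[OF assms(2) a(1) f] B.comp_assoc F H G a(2-) b(2-) A.cod_in A.dom_in)
    finally show "At (\<beta> \<bullet> \<alpha>) (Cod A f) \<cdot>\<^bsub>B\<^esub> ArM F f = ArM H f \<cdot>\<^bsub>B\<^esub> At (\<beta> \<bullet> \<alpha>) (Dom A f)"
      using f by (simp add: F G a(2-) b(2-) A.cod_in A.dom_in B.comp_assoc)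
  qed (simp_all add: a(2-) b(2-) F B.comp_in B.comp_dom B.comp_cod, simp add: vcomp_def a(2) F)
qed

lemma whisker_left_Nat:
  assumes "\<tau> \<in> Nat F G" "F \<in> Fun A B" "H \<in> Fun B C"
  shows "H \<triangleright> \<tau> \<in> Nat (H \<circ>\<^sub>F F) (H \<circ>\<^sub>F G)"
proof -
  note t = NatD[OF assms(1,2)]
  note F = FunD[OF assms(2)] and G = FunD[OF t(1)] and H = FunD[OF assms(3)]
  interpret A: category A by (rule F)
  show ?thesis
  proof (rule NatI[OF fcomp_Fun[OF assms(2,3)] fcomp_Fun[OF t(1) assms(3)]])
    fix f assume f: "f \<in> Arr A"
    have "ArM H (At \<tau> (Cod A f) \<cdot>\<^bsub>B\<^esub> ArM F f) = ArM H (ArM G f \<cdot>\<^bsub>B\<^esub> At \<tau> (Dom A f))"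
      by (simp add: Nat_naturality[OF assms(1,2) f])
    then show "At (H \<triangleright> \<tau>) (Cod A f) \<cdot>\<^bsub>C\<^esub> ArM (H \<circ>\<^sub>F F) f =
        ArM (H \<circ>\<^sub>F G) f \<cdot>\<^bsub>C\<^esub> At (H \<triangleright> \<tau>) (Dom A f)"
      using f by (simp add: F G H t(2-) A.cod_in A.dom_in)
  qed (simp_all add: t(2-) F G H, simp add: whisker_left_def t(2) F)
qed

lemma whisker_right_Nat:
  assumes "\<tau> \<in> Nat F G" "F \<in> Fun B C" "H \<in> Fun A B"
  shows "\<tau> \<triangleleft> H \<in> Nat (F \<circ>\<^sub>F H) (G \<circ>\<^sub>F H)"
proof -
  note t = NatD[OF assms(1,2)]
  note F = FunD[OF assms(2)] and G = FunD[OF t(1)] and H = FunD[OF assms(3)]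
  interpret A: category A by (rule H)
  show ?thesis
  proof (rule NatI[OF fcomp_Fun[OF assms(3,2)] fcomp_Fun[OF assms(3) t(1)]])
    fix f assume f: "f \<in> Arr A"
    show "At (\<tau> \<triangleleft> H) (Cod A f) \<cdot>\<^bsub>C\<^esub> ArM (F \<circ>\<^sub>F H) f =
        ArM (G \<circ>\<^sub>F H) f \<cdot>\<^bsub>C\<^esub> At (\<tau> \<triangleleft> H) (Dom A f)"
      using f Nat_naturality[OF assms(1,2), of "ArM H f"]
      by (simp add: F G H t(2-) A.cod_in A.dom_in)
  qed (simp_all add: t(2-) F G H, simp add: whisker_right_def H)
qed

lemma vcomp_assoc:
  assumes "\<alpha> \<in> Nat F G" "\<beta> \<in> Nat G H" "\<gamma> \<in> Nat H K" "F \<in> Fun A B"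
  shows "\<gamma> \<bullet> \<beta> \<bullet> \<alpha> = \<gamma> \<bullet> (\<beta> \<bullet> \<alpha>)"
proof -
  note a = NatD[OF assms(1,4)]
  note b = NatD[OF assms(2) a(1)]
  note c = NatD[OF assms(3) b(1)]
  note F = FunD[OF assms(4)] and G = FunD[OF a(1)]
  interpret B: category B by (rule F)
  have 1: "\<gamma> \<bullet> \<beta> \<bullet> \<alpha> \<in> Nat F K"
    by (rule vcomp_Nat[OF assms(1) vcomp_Nat[OF assms(2,3) a(1)] assms(4)])
  have 2: "\<gamma> \<bullet> (\<beta> \<bullet> \<alpha>) \<in> Nat F K"
    by (rule vcomp_Nat[OF vcomp_Nat[OF assms(1,2,4)] assms(3,4)])
  show ?thesis
    by (rule Nat_eqI[OF 1 2 assms(4)]) (simp add: a(2-) b(2-) c(2-) F G B.comp_assoc)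
qed

lemma vcomp_id_left:
  assumes "\<alpha> \<in> Nat F G" "F \<in> Fun A B"
  shows "id_nat G \<bullet> \<alpha> = \<alpha>"
proof -
  note a = NatD[OF assms]
  note F = FunD[OF assms(2)] and G = FunD[OF a(1)]
  interpret B: category B by (rule F)
  have "Ident B (ObM G X) \<cdot>\<^bsub>B\<^esub> At \<alpha> X = At \<alpha> X" if "X \<in> Obj A" for X
    using B.ident_left[of "At \<alpha> X"] that by (simp add: a)
  then show ?thesis
    by (intro Nat_eqI[OF vcomp_Nat[OF assms(1) id_nat_Nat[OF a(1)] assms(2)] assms])
      (simp add: a(2-) F G)
qed

lemma vcomp_id_right:
  assumes "\<alpha> \<in> Nat F G" "F \<in> Fun A B"
  shows "\<alpha> \<bullet> id_nat F = \<alpha>"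
proof -
  note a = NatD[OF assms]
  note F = FunD[OF assms(2)] and G = FunD[OF a(1)]
  interpret B: category B by (rule F)
  have "At \<alpha> X \<cdot>\<^bsub>B\<^esub> Ident B (ObM F X) = At \<alpha> X" if "X \<in> Obj A" for X
    using B.ident_right[of "At \<alpha> X"] that by (simp add: a)
  then show ?thesis
    by (intro Nat_eqI[OF vcomp_Nat[OF id_nat_Nat[OF assms(2)] assms] assms]) (simp add: a(2-) F G)
qed

lemma whisker_right_vcomp:
  assumes "\<alpha> \<in> Nat F G" "\<beta> \<in> Nat G H" "F \<in> Fun B C" "K \<in> Fun A B"
  shows "(\<beta> \<bullet> \<alpha>) \<triangleleft> K = \<beta> \<triangleleft> K \<bullet> \<alpha> \<triangleleft> K"
proof -
  note a = NatD[OF assms(1,3)]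
  note b = NatD[OF assms(2) a(1)]
  show ?thesis
    by (rule Nat_eqI[OF whisker_right_Nat[OF vcomp_Nat[OF assms(1-3)] assms(3,4)]
        vcomp_Nat[OF whisker_right_Nat[OF assms(1,3,4)] whisker_right_Nat[OF assms(2) a(1) assms(4)]
          fcomp_Fun[OF assms(4,3)]] fcomp_Fun[OF assms(4,3)]])
      (simp add: a(2-) b(2-) FunD[OF assms(3)] FunD[OF assms(4)])
qed

lemma whisker_left_vcomp:
  assumes "\<alpha> \<in> Nat F G" "\<beta> \<in> Nat G H" "F \<in> Fun A B" "K \<in> Fun B C"
  shows "K \<triangleright> (\<beta> \<bullet> \<alpha>) = K \<triangleright> \<beta> \<bullet> K \<triangleright> \<alpha>"
proof -
  note a = NatD[OF assms(1,3)]
  note b = NatD[OF assms(2) a(1)]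
  show ?thesis
    by (rule Nat_eqI[OF whisker_left_Nat[OF vcomp_Nat[OF assms(1-3)] assms(3,4)]
        vcomp_Nat[OF whisker_left_Nat[OF assms(1,3,4)] whisker_left_Nat[OF assms(2) a(1) assms(4)]
          fcomp_Fun[OF assms(3,4)]] fcomp_Fun[OF assms(3,4)]])
      (simp add: a(2-) b(2-) FunD[OF assms(3)] FunD[OF assms(4)] FunD[OF a(1)])
qed

lemma whisker_right_id:
  assumes "F \<in> Fun B C" "K \<in> Fun A B"
  shows "id_nat F \<triangleleft> K = id_nat (F \<circ>\<^sub>F K)"
  by (rule Nat_eqI[OF whisker_right_Nat[OF id_nat_Nat[OF assms(1)] assms]
      id_nat_Nat[OF fcomp_Fun[OF assms(2,1)]] fcomp_Fun[OF assms(2,1)]])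
    (simp add: FunD[OF assms(1)] FunD[OF assms(2)])

lemma whisker_left_id:
  assumes "F \<in> Fun A B" "K \<in> Fun B C"
  shows "K \<triangleright> id_nat F = id_nat (K \<circ>\<^sub>F F)"
  by (rule Nat_eqI[OF whisker_left_Nat[OF id_nat_Nat[OF assms(1)] assms]
      id_nat_Nat[OF fcomp_Fun[OF assms(1,2)]] fcomp_Fun[OF assms(1,2)]])
    (simp add: FunD[OF assms(1)] FunD[OF assms(2)])


section \<open>Right Kan extensions\<close>

lemma is_ranD:
  assumes "is_ran G F R c" "G \<in> Fun A D" "F \<in> Fun A C"
  shows "R \<in> Fun D C" "c \<in> Nat (R \<circ>\<^sub>F G) F"
    and "\<lbrakk>H \<in> Fun D C; \<alpha> \<in> Nat (H \<circ>\<^sub>F G) F\<rbrakk> \<Longrightarrow> \<exists>!\<beta>. \<beta> \<in> Nat H R \<and> c \<bullet> \<beta> \<triangleleft> G = \<alpha>"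
  using assms(1) FunD(4,5)[OF assms(2)] FunD(5)[OF assms(3)] unfolding is_ran_def by auto

text \<open>Each universal property yields a map into the extension it belongs to, and either round
  trip solves the same factorization problem as an identity.\<close>

lemma is_ran_comparison:
  assumes R: "is_ran G F R c" and R': "is_ran G F R' c'" and G: "G \<in> Fun A D" and F: "F \<in> Fun A C"
  obtains \<theta> \<theta>' where "\<theta> \<in> Nat R R'" "\<theta>' \<in> Nat R' R" "c' \<bullet> \<theta> \<triangleleft> G = c"
    "\<theta>' \<bullet> \<theta> = id_nat R" "\<theta> \<bullet> \<theta>' = id_nat R'"
proof -
  \<comment> \<open>Stated for an arbitrary pair of extensions, so that the same argument, with the
    roles exchanged, settles both composites.\<close>
  have retract: "\<theta>' \<bullet> \<theta> = id_nat R"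
    if r: "is_ran G F R c" and "is_ran G F R' c'" and t: "\<theta> \<in> Nat R R'" "\<theta>' \<in> Nat R' R" "c' \<bullet> \<theta> \<triangleleft> G = c"
      "c \<bullet> \<theta>' \<triangleleft> G = c'" for R R' c c' \<theta> \<theta>'
  proof -
    note R = is_ranD[OF r G F]
    note R' = is_ranD[OF that(2) G F]
    have "c \<bullet> (\<theta>' \<bullet> \<theta>) \<triangleleft> G = c \<bullet> (\<theta>' \<triangleleft> G \<bullet> \<theta> \<triangleleft> G)"
      by (simp add: whisker_right_vcomp[OF t(1,2) R(1) G])
    also have "\<dots> = c"
      using vcomp_assoc[OF whisker_right_Nat[OF t(1) R(1) G] whisker_right_Nat[OF t(2) R'(1) G] R(2)
          fcomp_Fun[OF G R(1)]] t(3,4) by simp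
    finally have "c \<bullet> (\<theta>' \<bullet> \<theta>) \<triangleleft> G = c" .
    moreover have "c \<bullet> id_nat R \<triangleleft> G = c"
      by (simp add: whisker_right_id[OF R(1) G] vcomp_id_right[OF R(2) fcomp_Fun[OF G R(1)]])
    ultimately show ?thesis
      using R(3)[OF R(1,2)] vcomp_Nat[OF t(1,2) R(1)] id_nat_Nat[OF R(1)] by blast
  qed
  note r = is_ranD[OF R G F] and r' = is_ranD[OF R' G F]
  from r'(3)[OF r(1,2)] obtain \<theta> where 1: "\<theta> \<in> Nat R R'" "c' \<bullet> \<theta> \<triangleleft> G = c" by blast
  from r(3)[OF r'(1,2)] obtain \<theta>' where 2: "\<theta>' \<in> Nat R' R" "c \<bullet> \<theta>' \<triangleleft> G = c'" by blast
  from 1 2 show thesis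
    by (intro that[of \<theta> \<theta>'] retract[OF R R'] retract[OF R' R])
qed

text \<open>An adjunction \<open>J -| K\<close> makes precomposition with \<open>K\<close> left
  adjoint to precomposition with \<open>J\<close>, with unit \<open>H \<eta>\<close> and counit
  \<open>F \<epsilon>\<close>. As \<open>F\<close> is arbitrary, the extension is absolute: a
  composite \<open>p F\<close> is just another instance.\<close>

lemma is_ran_right_adjoint:
  assumes J: "J \<in> Fun D A" and K: "K \<in> Fun A D" and F: "F \<in> Fun A C"
    and eta: "\<eta> \<in> Nat (id_functor D) (K \<circ>\<^sub>F J)" and eps: "\<epsilon> \<in> Nat (J \<circ>\<^sub>F K) (id_functor A)"
    and tri_J: "\<And>X. X \<in> Obj D \<Longrightarrow> At \<epsilon> (ObM J X) \<cdot>\<^bsub>A\<^esub> ArM J (At \<eta> X) = Ident A (ObM J X)"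
    and tri_K: "\<And>X. X \<in> Obj A \<Longrightarrow> ArM K (At \<epsilon> X) \<cdot>\<^bsub>D\<^esub> At \<eta> (ObM K X) = Ident D (ObM K X)"
  shows "is_ran K F (F \<circ>\<^sub>F J) (F \<triangleright> \<epsilon>)"
proof -
  note j = FunD[OF J] and k = FunD[OF K] and f = FunD[OF F]
  interpret A: category A by (rule k)
  interpret C: category C by (rule f)
  interpret D: category D by (rule k)
  note idD = id_functor_Fun[OF D.category_axioms] and idA = id_functor_Fun[OF A.category_axioms]
  note eta' = NatD[OF eta idD] and eps' = NatD[OF eps fcomp_Fun[OF K J]]
  have c: "F \<triangleright> \<epsilon> \<in> Nat (F \<circ>\<^sub>F J \<circ>\<^sub>F K) F"
    using whisker_left_Nat[OF eps fcomp_Fun[OF K J] F]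
    by (simp add: fcomp_assoc[OF K J] fcomp_id_right[OF F])
  note c' = NatD[OF c fcomp_Fun[OF K fcomp_Fun[OF J F]]]
  have "\<exists>!\<beta>. \<beta> \<in> Nat H (F \<circ>\<^sub>F J) \<and> F \<triangleright> \<epsilon> \<bullet> \<beta> \<triangleleft> K = \<alpha>"
    if H: "H \<in> Fun D C" and al: "\<alpha> \<in> Nat (H \<circ>\<^sub>F K) F" for H \<alpha>
  proof
    note h = FunD[OF H] and a = NatD[OF al fcomp_Fun[OF K H]]
    \<comment> \<open>The transpose of \<alpha> under that adjunction. The triangle identity
      \<open>tri_K\<close> shows that it factors \<alpha>, and \<open>tri_J\<close> that no other
      transformation does.\<close>
    let ?b = "\<alpha> \<triangleleft> J \<bullet> H \<triangleright> \<eta>"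
    have e: "H \<triangleright> \<eta> \<in> Nat H (H \<circ>\<^sub>F K \<circ>\<^sub>F J)"
      using whisker_left_Nat[OF eta idD H] by (simp add: fcomp_assoc[OF J K] fcomp_id_right[OF H])
    have b: "?b \<in> Nat H (F \<circ>\<^sub>F J)"
      by (rule vcomp_Nat[OF e whisker_right_Nat[OF al fcomp_Fun[OF K H] J] H])
    show "?b \<in> Nat H (F \<circ>\<^sub>F J) \<and> F \<triangleright> \<epsilon> \<bullet> ?b \<triangleleft> K = \<alpha>"
    proof
      show "F \<triangleright> \<epsilon> \<bullet> ?b \<triangleleft> K = \<alpha>"
      proof (rule Nat_eqI[OF vcomp_Nat[OF whisker_right_Nat[OF b H K] c fcomp_Fun[OF K H]] al
            fcomp_Fun[OF K H]])
        fix X assume X: "X \<in> Obj A"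
        have "At (F \<triangleright> \<epsilon> \<bullet> ?b \<triangleleft> K) X =
            (ArM F (At \<epsilon> X) \<cdot>\<^bsub>C\<^esub> At \<alpha> (ObM J (ObM K X))) \<cdot>\<^bsub>C\<^esub> ArM H (At \<eta> (ObM K X))"
          using X by (simp add: j k f h a(2-) eta'(2-) eps'(2-) C.comp_assoc)
        \<comment> \<open>Naturality of \<alpha> at the counit brings the two halves of the triangle
          for \<open>K\<close> next to each other.\<close>
        also have "ArM F (At \<epsilon> X) \<cdot>\<^bsub>C\<^esub> At \<alpha> (ObM J (ObM K X)) = At \<alpha> X \<cdot>\<^bsub>C\<^esub> ArM H (ArM K (At \<epsilon> X))"
          using Nat_naturality[OF al fcomp_Fun[OF K H] eps'(5)[OF X]] X
          by (simp add: j k f h a(2-) eps'(2-))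
        also have "\<dots> \<cdot>\<^bsub>C\<^esub> ArM H (At \<eta> (ObM K X)) =
            At \<alpha> X \<cdot>\<^bsub>C\<^esub> ArM H (ArM K (At \<epsilon> X) \<cdot>\<^bsub>D\<^esub> At \<eta> (ObM K X))"
          using X by (simp add: j k f h a(2-) eta'(2-) eps'(2-) C.comp_assoc)
        also have "\<dots> = At \<alpha> X"
          using X C.ident_right[OF a(5)[OF X]] by (simp add: tri_K h k a(2-))
        finally show "At (F \<triangleright> \<epsilon> \<bullet> ?b \<triangleleft> K) X = At \<alpha> X" .
      qed
    qed (rule b)
    fix \<beta> assume be: "\<beta> \<in> Nat H (F \<circ>\<^sub>F J) \<and> F \<triangleright> \<epsilon> \<bullet> \<beta> \<triangleleft> K = \<alpha>"
    then have be1: "\<beta> \<in> Nat H (F \<circ>\<^sub>F J)" by simp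
    note b' = NatD[OF be1 H]
    show "\<beta> = ?b"
    proof (rule Nat_eqI[OF be1 b H])
      fix X assume X: "X \<in> Obj D"
      have "At ?b X = At (F \<triangleright> \<epsilon> \<bullet> \<beta> \<triangleleft> K) (ObM J X) \<cdot>\<^bsub>C\<^esub> ArM H (At \<eta> X)"
        using X be by (simp add: j k f h a(2-) eta'(2-) eps'(2-))
      also have "\<dots> = ArM F (At \<epsilon> (ObM J X)) \<cdot>\<^bsub>C\<^esub> (At \<beta> (ObM K (ObM J X)) \<cdot>\<^bsub>C\<^esub> ArM H (At \<eta> X))"
        using X by (simp add: j k f h b'(2-) eta'(2-) eps'(2-) C.comp_assoc)
      \<comment> \<open>Dually, naturality of \<beta> at the unit exposes the triangle for
        \<open>J\<close>.\<close>
      also have "At \<beta> (ObM K (ObM J X)) \<cdot>\<^bsub>C\<^esub> ArM H (At \<eta> X) = ArM F (ArM J (At \<eta> X)) \<cdot>\<^bsub>C\<^esub> At \<beta> X"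
        using Nat_naturality[OF be1 H eta'(5)[OF X]] X by (simp add: j k f h eta'(2-))
      also have "ArM F (At \<epsilon> (ObM J X)) \<cdot>\<^bsub>C\<^esub> \<dots> =
          ArM F (At \<epsilon> (ObM J X) \<cdot>\<^bsub>A\<^esub> ArM J (At \<eta> X)) \<cdot>\<^bsub>C\<^esub> At \<beta> X"
        using X by (simp add: j k f h b'(2-) eta'(2-) eps'(2-) C.comp_assoc)
      also have "\<dots> = At \<beta> X"
        using X C.ident_left[OF b'(5)[OF X]] by (simp add: tri_J f j b'(2-))
      finally show "At \<beta> X = At ?b X" by simp
    qed
  qed
  then show ?thesis
    unfolding is_ran_def using k f c fcomp_Fun[OF J F] by simp
qed

section \<open>Monads and Kleisli resolutions\<close>

locale monad = C: category C for C :: "('o, 'm) cat" +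
  fixes T :: "('o, 'm) mnd"
  assumes monad: "monad_on C T"
begin

lemma MFun: "MFun T \<in> Fun C C"
  and Unit: "Unit T \<in> Nat (id_functor C) (MFun T)"
  and Mult: "Mult T \<in> Nat (MFun T \<circ>\<^sub>F MFun T) (MFun T)"
  using monad by (auto simp: monad_on_def)

lemmas id_Fun = id_functor_Fun[OF C.category_axioms]
lemmas TT_Fun = fcomp_Fun[OF MFun MFun]
lemmas MFunD = FunD[OF MFun]
lemmas UnitD = NatD[OF Unit id_Fun]
lemmas MultD = NatD[OF Mult TT_Fun]

lemma unit_natural:
  "f \<in> Arr C \<Longrightarrow> At (Unit T) (Cod C f) \<cdot>\<^bsub>C\<^esub> f = ArM (MFun T) f \<cdot>\<^bsub>C\<^esub> At (Unit T) (Dom C f)"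
  using Nat_naturality[OF Unit id_Fun, of f] by simp

lemma mult_natural:
  "f \<in> Arr C \<Longrightarrow> At (Mult T) (Cod C f) \<cdot>\<^bsub>C\<^esub> ArM (MFun T) (ArM (MFun T) f) =
    ArM (MFun T) f \<cdot>\<^bsub>C\<^esub> At (Mult T) (Dom C f)"
  using Nat_naturality[OF Mult TT_Fun, of f] by (simp add: MFunD)

lemma mult_unit:
  assumes "X \<in> Obj C"
  shows "At (Mult T) X \<cdot>\<^bsub>C\<^esub> At (Unit T) (ObM (MFun T) X) = Ident C (ObM (MFun T) X)"
proof -
  have "At (Mult T \<bullet> Unit T \<triangleleft> MFun T) X = At (id_nat (MFun T)) X"
    using monad by (simp add: monad_on_def)
  then show ?thesis using assms by (simp add: MFunD UnitD(2-) MultD(2-))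
qed

lemma mult_map_unit:
  assumes "X \<in> Obj C"
  shows "At (Mult T) X \<cdot>\<^bsub>C\<^esub> ArM (MFun T) (At (Unit T) X) = Ident C (ObM (MFun T) X)"
proof -
  have "At (Mult T \<bullet> MFun T \<triangleright> Unit T) X = At (id_nat (MFun T)) X"
    using monad by (simp add: monad_on_def)
  then show ?thesis using assms by (simp add: MFunD UnitD(2-) MultD(2-))
qed

lemma mult_assoc:
  assumes "X \<in> Obj C"
  shows "At (Mult T) X \<cdot>\<^bsub>C\<^esub> At (Mult T) (ObM (MFun T) X) =
    At (Mult T) X \<cdot>\<^bsub>C\<^esub> ArM (MFun T) (At (Mult T) X)"
proof -
  have "At (Mult T \<bullet> Mult T \<triangleleft> MFun T) X = At (Mult T \<bullet> MFun T \<triangleright> Mult T) X"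
    using monad by (simp add: monad_on_def)
  then show ?thesis using assms by (simp add: MFunD MultD(2-))
qed

text \<open>Typing facts and preservation of identities. Preservation of composites,
  \<open>MFunD(11)\<close>, is kept apart, since the image of a composite is to be split only where
  a chain of equations asks for it.\<close>

lemmas typing = MFunD(4-10) UnitD(2-3,5-7) MultD(2-3,5-7)
  C.dom_in C.cod_in C.ident_in C.ident_dom C.ident_cod C.comp_in C.comp_dom C.comp_cod

section \<open>The Kleisli category\<close>

lemma kleisli_sel [simp]:
  "Obj (kleisli T) = Obj C"
  "(f, Y) \<in> Arr (kleisli T) \<longleftrightarrow> f \<in> Arr C \<and> Y \<in> Obj C \<and> Cod C f = ObM (MFun T) Y"
  "Dom (kleisli T) (f, Y) = Dom C f"
  "Cod (kleisli T) (f, Y) = Y"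
  "Ident (kleisli T) X = (At (Unit T) X, X)"
  "(g, Z) \<cdot>\<^bsub>kleisli T\<^esub> (f, Y) = (At (Mult T) Z \<cdot>\<^bsub>C\<^esub> (ArM (MFun T) g \<cdot>\<^bsub>C\<^esub> f), Z)"
  by (simp_all add: kleisli_def Let_def MFunD)

lemma kleisli_K_sel [simp]:
  "(f, Y) \<in> Arr (kleisli T) \<Longrightarrow>
    ArM (kleisli_K T) (f, Y) = At (Mult T) Y \<cdot>\<^bsub>C\<^esub> ArM (MFun T) f"
  "X \<in> Obj C \<Longrightarrow> ObM (kleisli_K T) X = ObM (MFun T) X"
  "Src (kleisli_K T) = kleisli T" "Tgt (kleisli_K T) = C"
  by (simp_all add: kleisli_K_def Let_def MFunD)

lemma kleisli_J_sel [simp]: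
  "f \<in> Arr C \<Longrightarrow> ArM (kleisli_J T) f = (At (Unit T) (Cod C f) \<cdot>\<^bsub>C\<^esub> f, Cod C f)"
  "X \<in> Obj C \<Longrightarrow> ObM (kleisli_J T) X = X"
  "Src (kleisli_J T) = C" "Tgt (kleisli_J T) = kleisli T"
  by (simp_all add: kleisli_J_def Let_def MFunD)

text \<open>The unit law with a further arrow on the right, the shape in which it occurs inside
  composites bracketed to the right by \<open>C.comp_assoc\<close>. The next lemma does the same for
  the other unit law.\<close>

lemma mult_unit_cancel:
  assumes "f \<in> Arr C" "Y \<in> Obj C" "Cod C f = ObM (MFun T) Y"
  shows "At (Mult T) Y \<cdot>\<^bsub>C\<^esub> (At (Unit T) (ObM (MFun T) Y) \<cdot>\<^bsub>C\<^esub> f) = f"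
  using C.comp_assoc[of f "At (Unit T) (ObM (MFun T) Y)" "At (Mult T) Y"] C.ident_left[of f] assms
  by (simp add: typing mult_unit)

lemma mult_map_unit_cancel:
  assumes "f \<in> Arr C" "Y \<in> Obj C" "Cod C f = ObM (MFun T) Y"
  shows "At (Mult T) Y \<cdot>\<^bsub>C\<^esub> (ArM (MFun T) (At (Unit T) Y) \<cdot>\<^bsub>C\<^esub> f) = f"
  using C.comp_assoc[of f "ArM (MFun T) (At (Unit T) Y)" "At (Mult T) Y"] C.ident_left[of f] assms
  by (simp add: typing mult_map_unit)

text \<open>Kleisli extension sends \<open>f\<close> to multiplication after \<open>T f\<close>; it
  turns Kleisli composites into ordinary ones by associativity and naturality of the multiplication.
  This one fact gives both associativity in the Kleisli category and functoriality of
  \<open>K\<close>.\<close>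

lemma kleisli_extension_comp:
  assumes "g \<in> Arr C" "Z \<in> Obj C" "Cod C g = ObM (MFun T) Z"
    and "f \<in> Arr C" "Cod C f = ObM (MFun T) (Dom C g)"
  shows "At (Mult T) Z \<cdot>\<^bsub>C\<^esub> ArM (MFun T) (At (Mult T) Z \<cdot>\<^bsub>C\<^esub> (ArM (MFun T) g \<cdot>\<^bsub>C\<^esub> f)) =
    (At (Mult T) Z \<cdot>\<^bsub>C\<^esub> ArM (MFun T) g) \<cdot>\<^bsub>C\<^esub> (At (Mult T) (Dom C g) \<cdot>\<^bsub>C\<^esub> ArM (MFun T) f)"
proof -
  let ?T = "ArM (MFun T)" and ?m = "At (Mult T)"
  have "?m Z \<cdot>\<^bsub>C\<^esub> ?T (?m Z \<cdot>\<^bsub>C\<^esub> (?T g \<cdot>\<^bsub>C\<^esub> f)) = (?m Z \<cdot>\<^bsub>C\<^esub> ?T (?m Z)) \<cdot>\<^bsub>C\<^esub> (?T (?T g) \<cdot>\<^bsub>C\<^esub> ?T f)"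
    using assms by (simp add: typing MFunD(11) C.comp_assoc)
  also have "?m Z \<cdot>\<^bsub>C\<^esub> ?T (?m Z) = ?m Z \<cdot>\<^bsub>C\<^esub> ?m (ObM (MFun T) Z)"
    using assms by (simp add: mult_assoc)
  also have "\<dots> \<cdot>\<^bsub>C\<^esub> (?T (?T g) \<cdot>\<^bsub>C\<^esub> ?T f) = ?m Z \<cdot>\<^bsub>C\<^esub> ((?m (Cod C g) \<cdot>\<^bsub>C\<^esub> ?T (?T g)) \<cdot>\<^bsub>C\<^esub> ?T f)"
    using assms by (simp add: typing C.comp_assoc)
  also have "?m (Cod C g) \<cdot>\<^bsub>C\<^esub> ?T (?T g) = ?T g \<cdot>\<^bsub>C\<^esub> ?m (Dom C g)"
    by (rule mult_natural[OF assms(1)])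
  finally show ?thesis
    using assms by (simp add: typing C.comp_assoc)
qed

text \<open>On arrows this is \<open>K (J f) = T f\<close>.\<close>

lemma mult_map_cod:
  assumes "f \<in> Arr C"
  shows "At (Mult T) (Cod C f) \<cdot>\<^bsub>C\<^esub> ArM (MFun T) (At (Unit T) (Cod C f) \<cdot>\<^bsub>C\<^esub> f) = ArM (MFun T) f"
  using assms mult_map_unit_cancel[of "ArM (MFun T) f" "Cod C f"] by (simp add: typing MFunD(11))

lemma kleisli_category: "category (kleisli T)"
proof
  fix x assume "x \<in> Arr (kleisli T)"
  then obtain f Y where x: "x = (f, Y)" and f: "f \<in> Arr C" "Y \<in> Obj C" "Cod C f = ObM (MFun T) Y"
    by (cases x) auto
  show "Dom (kleisli T) x \<in> Obj (kleisli T)" "Cod (kleisli T) x \<in> Obj (kleisli T)"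
    by (simp_all add: x f C.dom_in)
  show "Ident (kleisli T) (Cod (kleisli T) x) \<cdot>\<^bsub>kleisli T\<^esub> x = x"
    by (simp add: x f mult_map_unit_cancel)
  show "x \<cdot>\<^bsub>kleisli T\<^esub> Ident (kleisli T) (Dom (kleisli T) x) = x"
    using mult_unit_cancel[OF f] f(3) unit_natural[OF f(1)] by (simp add: x)
next
  fix X assume "X \<in> Obj (kleisli T)"
  then show "Ident (kleisli T) X \<in> Arr (kleisli T)" "Dom (kleisli T) (Ident (kleisli T) X) = X"
    "Cod (kleisli T) (Ident (kleisli T) X) = X" by (simp_all add: typing)
next
  fix x y assume "x \<in> Arr (kleisli T)" "y \<in> Arr (kleisli T)" "Dom (kleisli T) y = Cod (kleisli T) x"
  then obtain f Y g Z where "x = (f, Y)" "y = (g, Z)" "f \<in> Arr C" "Y \<in> Obj C" "Cod C f = ObM (MFun T) Y"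
    "g \<in> Arr C" "Z \<in> Obj C" "Cod C g = ObM (MFun T) Z" "Dom C g = Y"
    by (cases x, cases y) auto
  then show "y \<cdot>\<^bsub>kleisli T\<^esub> x \<in> Arr (kleisli T)" "Dom (kleisli T) (y \<cdot>\<^bsub>kleisli T\<^esub> x) = Dom (kleisli T) x"
    "Cod (kleisli T) (y \<cdot>\<^bsub>kleisli T\<^esub> x) = Cod (kleisli T) y"
    by (simp_all add: typing)
next
  fix x y z assume "x \<in> Arr (kleisli T)" "y \<in> Arr (kleisli T)" "z \<in> Arr (kleisli T)"
    "Dom (kleisli T) y = Cod (kleisli T) x" "Dom (kleisli T) z = Cod (kleisli T) y"
  then obtain f Y g Z h W where "x = (f, Y)" "y = (g, Z)" "z = (h, W)"
    "f \<in> Arr C" "Y \<in> Obj C" "Cod C f = ObM (MFun T) Y"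
    "g \<in> Arr C" "Z \<in> Obj C" "Cod C g = ObM (MFun T) Z" "Dom C g = Y"
    "h \<in> Arr C" "W \<in> Obj C" "Cod C h = ObM (MFun T) W" "Dom C h = Z"
    by (cases x, cases y, cases z) auto
  note assms = this
  let ?T = "ArM (MFun T)" and ?m = "At (Mult T)"
  have "?m W \<cdot>\<^bsub>C\<^esub> (?T (?m W \<cdot>\<^bsub>C\<^esub> (?T h \<cdot>\<^bsub>C\<^esub> g)) \<cdot>\<^bsub>C\<^esub> f) =
      (?m W \<cdot>\<^bsub>C\<^esub> ?T (?m W \<cdot>\<^bsub>C\<^esub> (?T h \<cdot>\<^bsub>C\<^esub> g))) \<cdot>\<^bsub>C\<^esub> f"
    using assms(4-) by (simp add: typing C.comp_assoc)
  also have "\<dots> = ((?m W \<cdot>\<^bsub>C\<^esub> ?T h) \<cdot>\<^bsub>C\<^esub> (?m Z \<cdot>\<^bsub>C\<^esub> ?T g)) \<cdot>\<^bsub>C\<^esub> f"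
    using kleisli_extension_comp[of h W g] assms(4-) by simp
  also have "\<dots> = ?m W \<cdot>\<^bsub>C\<^esub> (?T h \<cdot>\<^bsub>C\<^esub> (?m Z \<cdot>\<^bsub>C\<^esub> (?T g \<cdot>\<^bsub>C\<^esub> f)))"
    using assms(4-) by (simp add: typing C.comp_assoc)
  finally show "(z \<cdot>\<^bsub>kleisli T\<^esub> y) \<cdot>\<^bsub>kleisli T\<^esub> x = z \<cdot>\<^bsub>kleisli T\<^esub> (y \<cdot>\<^bsub>kleisli T\<^esub> x)"
    by (simp add: assms(1-3))
qed

section \<open>The Kleisli adjunction and Kan extensions along its right adjoint\<close>

lemma kleisli_J_Fun: "kleisli_J T \<in> Fun C (kleisli T)"
proof -
  have J: "ArM (kleisli_J T) (g \<cdot>\<^bsub>C\<^esub> f) = ArM (kleisli_J T) g \<cdot>\<^bsub>kleisli T\<^esub> ArM (kleisli_J T) f"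
    if f: "f \<in> Arr C" and g: "g \<in> Arr C" "Dom C g = Cod C f" for f g
  proof -
    have "At (Mult T) (Cod C g) \<cdot>\<^bsub>C\<^esub> (ArM (MFun T) (At (Unit T) (Cod C g) \<cdot>\<^bsub>C\<^esub> g) \<cdot>\<^bsub>C\<^esub>
        (At (Unit T) (Cod C f) \<cdot>\<^bsub>C\<^esub> f)) =
      ArM (MFun T) g \<cdot>\<^bsub>C\<^esub> (At (Unit T) (Dom C g) \<cdot>\<^bsub>C\<^esub> f)"
      using f g mult_map_cod[OF g(1)] by (simp add: typing flip: C.comp_assoc)
    also have "\<dots> = At (Unit T) (Cod C g) \<cdot>\<^bsub>C\<^esub> (g \<cdot>\<^bsub>C\<^esub> f)"
      using f g unit_natural[OF g(1)] by (simp add: typing flip: C.comp_assoc)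
    finally show ?thesis using f g by (simp add: typing)
  qed
  have "ObM (kleisli_J T) \<in> extensional (Obj C)" "ArM (kleisli_J T) \<in> extensional (Arr C)"
    by (simp_all add: kleisli_J_def Let_def MFunD)
  moreover have "At (Unit T) X \<cdot>\<^bsub>C\<^esub> Ident C X = At (Unit T) X" if "X \<in> Obj C" for X
    using C.ident_right[of "At (Unit T) X"] that by (simp add: typing)
  ultimately show ?thesis
    using J
    by (auto simp: Fun_def is_functor_def PiE_def C.category_axioms kleisli_category typing)
qed

lemma kleisli_K_Fun: "kleisli_K T \<in> Fun (kleisli T) C"
proof -
  have "ObM (kleisli_K T) \<in> extensional (Obj C)" "ArM (kleisli_K T) \<in> extensional (Arr (kleisli T))"
    by (auto simp: kleisli_K_def Let_def MFunD)
  then show ?thesis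
    by (auto simp: Fun_def is_functor_def PiE_def C.category_axioms kleisli_category typing
        mult_map_unit kleisli_extension_comp)
qed

lemma kleisli_K_J: "kleisli_K T \<circ>\<^sub>F kleisli_J T = MFun T"
  by (rule Fun_eqI[OF fcomp_Fun[OF kleisli_J_Fun kleisli_K_Fun] MFun])
    (simp_all add: typing mult_map_cod)

lemma kleisli_counit_sel [simp]:
  "NSrc (kleisli_counit T) = kleisli_J T \<circ>\<^sub>F kleisli_K T"
  "NTgt (kleisli_counit T) = id_functor (kleisli T)"
  "X \<in> Obj C \<Longrightarrow> At (kleisli_counit T) X = (Ident C (ObM (MFun T) X), X)"
  by (simp_all add: kleisli_counit_def MFunD)

lemma kleisli_counit_Nat:
  "kleisli_counit T \<in> Nat (kleisli_J T \<circ>\<^sub>F kleisli_K T) (id_functor (kleisli T))"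
proof (rule NatI[OF fcomp_Fun[OF kleisli_K_Fun kleisli_J_Fun] id_functor_Fun[OF kleisli_category]])
  fix x assume "x \<in> Arr (kleisli T)"
  then obtain f Y where x: "x = (f, Y)" and f: "f \<in> Arr C" "Y \<in> Obj C" "Cod C f = ObM (MFun T) Y"
    by (cases x) auto
  \<comment> \<open>This is the image of \<open>(f, Y)\<close> under \<open>K\<close>. Both sides of
    the naturality square turn out to be the Kleisli arrow \<open>(?x, Y)\<close>: on the left the
    unit inserted by \<open>J\<close> cancels against the multiplication, on the right only an
    identity is composed.\<close>
  let ?x = "At (Mult T) Y \<cdot>\<^bsub>C\<^esub> ArM (MFun T) f"
  have 1: "?x \<in> Arr C" "Dom C ?x = ObM (MFun T) (Dom C f)" "Cod C ?x = ObM (MFun T) Y"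
    using f by (simp_all add: typing)
  have "Ident C (ObM (MFun T) (ObM (MFun T) Y)) \<cdot>\<^bsub>C\<^esub> (At (Unit T) (ObM (MFun T) Y) \<cdot>\<^bsub>C\<^esub> ?x) =
     At (Unit T) (ObM (MFun T) Y) \<cdot>\<^bsub>C\<^esub> ?x"
    using C.ident_left[of "At (Unit T) (ObM (MFun T) Y) \<cdot>\<^bsub>C\<^esub> ?x"] f 1 by (simp add: typing)
  then have "At (Mult T) Y \<cdot>\<^bsub>C\<^esub> (Ident C (ObM (MFun T) (ObM (MFun T) Y)) \<cdot>\<^bsub>C\<^esub>
      (At (Unit T) (ObM (MFun T) Y) \<cdot>\<^bsub>C\<^esub> ?x)) = ?x"
    using mult_unit_cancel[OF 1(1) f(2) 1(3)] by simp
  moreover have "ArM (MFun T) f \<cdot>\<^bsub>C\<^esub> Ident C (ObM (MFun T) (Dom C f)) = ArM (MFun T) f"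
    using C.ident_right[of "ArM (MFun T) f"] f by (simp add: typing)
  ultimately show "At (kleisli_counit T) (Cod (kleisli T) x) \<cdot>\<^bsub>kleisli T\<^esub>
        ArM (kleisli_J T \<circ>\<^sub>F kleisli_K T) x =
      ArM (id_functor (kleisli T)) x \<cdot>\<^bsub>kleisli T\<^esub> At (kleisli_counit T) (Dom (kleisli T) x)"
    using f 1 by (simp add: x typing)
qed (simp_all add: typing, simp add: kleisli_counit_def)

text \<open>\<open>K\<close> extends an identity, read as a Kleisli arrow, to the bare
  multiplication. Equations involving the Kan extension counit thereby become the monad
  laws.\<close>

lemma kleisli_K_counit:
  "X \<in> Obj C \<Longrightarrow> ArM (kleisli_K T) (At (kleisli_counit T) X) = At (Mult T) X"
  using C.ident_right[of "At (Mult T) X"] by (simp add: typing)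

text \<open>Both triangle identities reduce to the unit law \<open>mult_unit\<close>. The freedom in
  \<open>F\<close> is used twice: \<open>F = K\<close> gives the Kan extension itself, and
  \<open>F\<close> equal to \<open>p\<close> after \<open>K\<close> gives its preservation.\<close>

lemma is_ran_kleisli_K:
  assumes "F \<in> Fun (kleisli T) A"
  shows "is_ran (kleisli_K T) F (F \<circ>\<^sub>F kleisli_J T) (F \<triangleright> kleisli_counit T)"
proof (rule is_ran_right_adjoint[OF kleisli_J_Fun kleisli_K_Fun assms _ kleisli_counit_Nat])
  show "Unit T \<in> Nat (id_functor C) (kleisli_K T \<circ>\<^sub>F kleisli_J T)"
    by (simp add: kleisli_K_J Unit)
  fix X assume X: "X \<in> Obj C"
  have "Ident C (ObM (MFun T) (ObM (MFun T) X)) \<cdot>\<^bsub>C\<^esub> (At (Unit T) (ObM (MFun T) X) \<cdot>\<^bsub>C\<^esub> At (Unit T) X) =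
     At (Unit T) (ObM (MFun T) X) \<cdot>\<^bsub>C\<^esub> At (Unit T) X"
    using C.ident_left[of "At (Unit T) (ObM (MFun T) X) \<cdot>\<^bsub>C\<^esub> At (Unit T) X"] X by (simp add: typing)
  then show "At (kleisli_counit T) (ObM (kleisli_J T) X) \<cdot>\<^bsub>kleisli T\<^esub> ArM (kleisli_J T) (At (Unit T) X) =
      Ident (kleisli T) (ObM (kleisli_J T) X)"
    using X mult_unit_cancel[of "At (Unit T) X" X] by (simp add: typing)
next
  fix X assume "X \<in> Obj (kleisli T)"
  then show "ArM (kleisli_K T) (At (kleisli_counit T) X) \<cdot>\<^bsub>C\<^esub> At (Unit T) (ObM (kleisli_K T) X) =
      Ident C (ObM (kleisli_K T) X)"
    by (simp only: kleisli_K_counit kleisli_sel kleisli_K_sel mult_unit)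
qed

end

text \<open>Each law of \<open>L\<close>, precomposed with suitable components of \<phi>, becomes
  the corresponding law of \<open>T\<close>. These components, and their images under
  \<open>MFun T\<close>, have sections coming from \<psi>, so they can be cancelled on the
  right.\<close>

lemma (in monad) monad_on_transport:
  assumes L: "MFun L \<in> Fun C C" and uL: "Unit L \<in> Nat (id_functor C) (MFun L)"
    and mL: "Mult L \<in> Nat (MFun L \<circ>\<^sub>F MFun L) (MFun L)"
    and phi: "\<phi> \<in> Nat (MFun T) (MFun L)" and psi: "\<psi> \<in> Nat (MFun L) (MFun T)"
    and inv: "\<phi> \<bullet> \<psi> = id_nat (MFun L)"
    and unit: "\<phi> \<bullet> Unit T = Unit L"
    and mult: "\<phi> \<bullet> Mult T = Mult L \<bullet> \<phi> \<triangleleft> MFun L \<bullet> MFun T \<triangleright> \<phi>"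
  shows "monad_on C L"
proof -
  let ?T = "MFun T" and ?L = "MFun L"
  note LL = fcomp_Fun[OF L L]
  note l = FunD[OF L] and u = NatD[OF uL id_Fun] and m = NatD[OF mL LL]
    and ph = NatD[OF phi MFun] and ps = NatD[OF psi L]
  note ty = typing l(4-10) u(2-3,5-7) m(2-3,5-7) ph(2-3,5-7) ps(2-3,5-7)
  have unit': "At (Unit L) X = At \<phi> X \<cdot>\<^bsub>C\<^esub> At (Unit T) X" if "X \<in> Obj C" for X
    using arg_cong[OF unit, of "\<lambda>\<tau>. At \<tau> X"] that by (simp add: ty)
  have mult': "At (Mult L) X \<cdot>\<^bsub>C\<^esub> (At \<phi> (ObM ?L X) \<cdot>\<^bsub>C\<^esub> ArM ?T (At \<phi> X)) =
      At \<phi> X \<cdot>\<^bsub>C\<^esub> At (Mult T) X" if "X \<in> Obj C" for X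
    using arg_cong[OF mult, of "\<lambda>\<tau>. At \<tau> X"] that by (simp add: ty C.comp_assoc)
  have nat: "At \<phi> Y \<cdot>\<^bsub>C\<^esub> ArM ?T f = ArM ?L f \<cdot>\<^bsub>C\<^esub> At \<phi> X"
    if "f \<in> Arr C" "Dom C f = X" "Cod C f = Y" for f X Y
    using Nat_naturality[OF phi MFun, of f] that by simp
  have inv': "At \<phi> X \<cdot>\<^bsub>C\<^esub> At \<psi> X = Ident C (ObM ?L X)" if "X \<in> Obj C" for X
    using arg_cong[OF inv, of "\<lambda>\<tau>. At \<tau> X"] that by (simp add: ty)
  \<comment> \<open>An arrow \<open>e\<close> with a section \<open>s\<close> is an
    epimorphism.\<close>
  have cancel: "f = g"
    if "f \<cdot>\<^bsub>C\<^esub> e = g \<cdot>\<^bsub>C\<^esub> e" "e \<cdot>\<^bsub>C\<^esub> s = Ident C (Cod C e)" "e \<in> Arr C" "s \<in> Arr C" "Cod C s = Dom C e"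
      "f \<in> Arr C" "g \<in> Arr C" "Dom C f = Cod C e" "Dom C g = Cod C e" for f g e s
  proof -
    have "f \<cdot>\<^bsub>C\<^esub> (e \<cdot>\<^bsub>C\<^esub> s) = g \<cdot>\<^bsub>C\<^esub> (e \<cdot>\<^bsub>C\<^esub> s)"
      using C.comp_assoc[of s e f] C.comp_assoc[of s e g] that(1,3-) by simp
    then show ?thesis
      using C.ident_right[of f] C.ident_right[of g] that by simp
  qed
  \<comment> \<open>Functors preserve sections, so \<open>T \<phi>\<close> and
    \<open>T T \<phi>\<close> can be cancelled as well.\<close>
  have map_inverse: "ArM ?T f \<cdot>\<^bsub>C\<^esub> ArM ?T g = Ident C (ObM ?T Y)"
    if "f \<cdot>\<^bsub>C\<^esub> g = Ident C Y" "f \<in> Arr C" "g \<in> Arr C" "Dom C f = Cod C g" "Y \<in> Obj C" for f g Y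
    using MFunD(11)[of g f] that by (simp add: ty)
  have cancel_phi: "f = g"
    if "f \<cdot>\<^bsub>C\<^esub> At \<phi> X = g \<cdot>\<^bsub>C\<^esub> At \<phi> X" "X \<in> Obj C"
      "f \<in> Arr C" "g \<in> Arr C" "Dom C f = ObM ?L X" "Dom C g = ObM ?L X" for f g X
    using cancel[of f "At \<phi> X" g "At \<psi> X"] that inv' by (simp add: ty)
  have cancel_T_phi: "f = g"
    if "f \<cdot>\<^bsub>C\<^esub> ArM ?T (At \<phi> X) = g \<cdot>\<^bsub>C\<^esub> ArM ?T (At \<phi> X)" "X \<in> Obj C"
      "f \<in> Arr C" "g \<in> Arr C" "Dom C f = ObM ?T (ObM ?L X)" "Dom C g = ObM ?T (ObM ?L X)" for f g X
  proof -
    have "ArM ?T (At \<phi> X) \<cdot>\<^bsub>C\<^esub> ArM ?T (At \<psi> X) = Ident C (ObM ?T (ObM ?L X))"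
      using that by (intro map_inverse) (simp_all add: inv' ty)
    then show ?thesis
      using cancel[of f "ArM ?T (At \<phi> X)" g "ArM ?T (At \<psi> X)"] that by (simp add: ty)
  qed
  \<comment> \<open>Naturality moves \<phi> to the left of the unit of \<open>T\<close>, where
    \<open>mult'\<close> trades the multiplication of \<open>L\<close> for that of
    \<open>T\<close>.\<close>
  have 1: "At (Mult L) X \<cdot>\<^bsub>C\<^esub> At (Unit L) (ObM ?L X) = Ident C (ObM ?L X)" if X: "X \<in> Obj C" for X
  proof (rule cancel_phi[OF _ X])
    have "(At (Mult L) X \<cdot>\<^bsub>C\<^esub> At (Unit L) (ObM ?L X)) \<cdot>\<^bsub>C\<^esub> At \<phi> X =
        At (Mult L) X \<cdot>\<^bsub>C\<^esub> (At \<phi> (ObM ?L X) \<cdot>\<^bsub>C\<^esub> (At (Unit T) (ObM ?L X) \<cdot>\<^bsub>C\<^esub> At \<phi> X))"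
      using X by (simp add: ty unit' C.comp_assoc)
    also have "At (Unit T) (ObM ?L X) \<cdot>\<^bsub>C\<^esub> At \<phi> X = ArM ?T (At \<phi> X) \<cdot>\<^bsub>C\<^esub> At (Unit T) (ObM ?T X)"
      using unit_natural[of "At \<phi> X"] X by (simp add: ty)
    also have "At (Mult L) X \<cdot>\<^bsub>C\<^esub> (At \<phi> (ObM ?L X) \<cdot>\<^bsub>C\<^esub> \<dots>) =
      (At (Mult L) X \<cdot>\<^bsub>C\<^esub> (At \<phi> (ObM ?L X) \<cdot>\<^bsub>C\<^esub> ArM ?T (At \<phi> X))) \<cdot>\<^bsub>C\<^esub> At (Unit T) (ObM ?T X)"
      using X by (simp add: ty C.comp_assoc)
    also have "\<dots> = At \<phi> X"
      using X C.ident_right[of "At \<phi> X"] by (simp add: mult' mult_unit ty C.comp_assoc)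
    also have "\<dots> = Ident C (ObM ?L X) \<cdot>\<^bsub>C\<^esub> At \<phi> X"
      using X C.ident_left[of "At \<phi> X"] by (simp add: ty)
    finally show "(At (Mult L) X \<cdot>\<^bsub>C\<^esub> At (Unit L) (ObM ?L X)) \<cdot>\<^bsub>C\<^esub> At \<phi> X =
        Ident C (ObM ?L X) \<cdot>\<^bsub>C\<^esub> At \<phi> X" .
  qed (use X in \<open>simp_all add: ty\<close>)
  have 2: "At (Mult L) X \<cdot>\<^bsub>C\<^esub> ArM ?L (At (Unit L) X) = Ident C (ObM ?L X)" if X: "X \<in> Obj C" for X
  proof (rule cancel_phi[OF _ X])
    have "(At (Mult L) X \<cdot>\<^bsub>C\<^esub> ArM ?L (At (Unit L) X)) \<cdot>\<^bsub>C\<^esub> At \<phi> X =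
        At (Mult L) X \<cdot>\<^bsub>C\<^esub> (At \<phi> (ObM ?L X) \<cdot>\<^bsub>C\<^esub> ArM ?T (At (Unit L) X))"
      using X by (simp add: nat[of "At (Unit L) X" X "ObM ?L X"] ty C.comp_assoc)
    also have "\<dots> = (At (Mult L) X \<cdot>\<^bsub>C\<^esub> (At \<phi> (ObM ?L X) \<cdot>\<^bsub>C\<^esub> ArM ?T (At \<phi> X))) \<cdot>\<^bsub>C\<^esub>
        ArM ?T (At (Unit T) X)"
      using X by (simp add: unit' MFunD(11) ty C.comp_assoc)
    also have "\<dots> = At \<phi> X"
      using X C.ident_right[of "At \<phi> X"] by (simp add: mult' mult_map_unit ty C.comp_assoc)
    also have "\<dots> = Ident C (ObM ?L X) \<cdot>\<^bsub>C\<^esub> At \<phi> X"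
      using X C.ident_left[of "At \<phi> X"] by (simp add: ty)
    finally show "(At (Mult L) X \<cdot>\<^bsub>C\<^esub> ArM ?L (At (Unit L) X)) \<cdot>\<^bsub>C\<^esub> At \<phi> X =
        Ident C (ObM ?L X) \<cdot>\<^bsub>C\<^esub> At \<phi> X" .
  qed (use X in \<open>simp_all add: ty\<close>)
  have 3: "At (Mult L) X \<cdot>\<^bsub>C\<^esub> At (Mult L) (ObM ?L X) = At (Mult L) X \<cdot>\<^bsub>C\<^esub> ArM ?L (At (Mult L) X)"
    if X: "X \<in> Obj C" for X
  proof -
    \<comment> \<open>The component at \<open>X\<close> of the horizontal composite of \<phi> with
      itself. Associativity is tested after precomposition with the threefold horizontal composite,
      namely \<phi> at \<open>L L X\<close> after \<open>ArM ?T ?e\<close>.\<close>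
    let ?e = "At \<phi> (ObM ?L X) \<cdot>\<^bsub>C\<^esub> ArM ?T (At \<phi> X)"
    let ?l = "(At (Mult L) X \<cdot>\<^bsub>C\<^esub> At (Mult L) (ObM ?L X)) \<cdot>\<^bsub>C\<^esub> At \<phi> (ObM ?L (ObM ?L X))"
    let ?r = "(At (Mult L) X \<cdot>\<^bsub>C\<^esub> ArM ?L (At (Mult L) X)) \<cdot>\<^bsub>C\<^esub> At \<phi> (ObM ?L (ObM ?L X))"
    have e: "?e \<in> Arr C" "Dom C ?e = ObM ?T (ObM ?T X)" "Cod C ?e = ObM ?L (ObM ?L X)"
      using X by (simp_all add: ty)
    have "?l \<cdot>\<^bsub>C\<^esub> ArM ?T ?e =
        At (Mult L) X \<cdot>\<^bsub>C\<^esub> ((At (Mult L) (ObM ?L X) \<cdot>\<^bsub>C\<^esub> (At \<phi> (ObM ?L (ObM ?L X)) \<cdot>\<^bsub>C\<^esub>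
          ArM ?T (At \<phi> (ObM ?L X)))) \<cdot>\<^bsub>C\<^esub> ArM ?T (ArM ?T (At \<phi> X)))"
      using X by (simp add: MFunD(11) ty C.comp_assoc)
    also have "\<dots> = At (Mult L) X \<cdot>\<^bsub>C\<^esub> (At \<phi> (ObM ?L X) \<cdot>\<^bsub>C\<^esub>
        (At (Mult T) (ObM ?L X) \<cdot>\<^bsub>C\<^esub> ArM ?T (ArM ?T (At \<phi> X))))"
      using X by (simp add: mult' ty C.comp_assoc)
    also have "At (Mult T) (ObM ?L X) \<cdot>\<^bsub>C\<^esub> ArM ?T (ArM ?T (At \<phi> X)) =
        ArM ?T (At \<phi> X) \<cdot>\<^bsub>C\<^esub> At (Mult T) (ObM ?T X)"
      using mult_natural[of "At \<phi> X"] X by (simp add: ty)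
    also have "At (Mult L) X \<cdot>\<^bsub>C\<^esub> (At \<phi> (ObM ?L X) \<cdot>\<^bsub>C\<^esub> \<dots>) =
        (At (Mult L) X \<cdot>\<^bsub>C\<^esub> ?e) \<cdot>\<^bsub>C\<^esub> At (Mult T) (ObM ?T X)"
      using X by (simp add: ty C.comp_assoc)
    also have "\<dots> = At \<phi> X \<cdot>\<^bsub>C\<^esub> (At (Mult T) X \<cdot>\<^bsub>C\<^esub> ArM ?T (At (Mult T) X))"
      using X by (simp add: mult' mult_assoc ty C.comp_assoc)
    also have "\<dots> = (At (Mult L) X \<cdot>\<^bsub>C\<^esub> ?e) \<cdot>\<^bsub>C\<^esub> ArM ?T (At (Mult T) X)"
      using X by (subst mult'[OF X]) (simp add: ty C.comp_assoc)
    also have "\<dots> = At (Mult L) X \<cdot>\<^bsub>C\<^esub> (At \<phi> (ObM ?L X) \<cdot>\<^bsub>C\<^esub> ArM ?T (At \<phi> X \<cdot>\<^bsub>C\<^esub> At (Mult T) X))"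
      using X by (simp add: MFunD(11) ty C.comp_assoc)
    also have "\<dots> = At (Mult L) X \<cdot>\<^bsub>C\<^esub> ((At \<phi> (ObM ?L X) \<cdot>\<^bsub>C\<^esub> ArM ?T (At (Mult L) X)) \<cdot>\<^bsub>C\<^esub> ArM ?T ?e)"
    proof -
      have "ArM ?T (At \<phi> X \<cdot>\<^bsub>C\<^esub> At (Mult T) X) = ArM ?T (At (Mult L) X) \<cdot>\<^bsub>C\<^esub> ArM ?T ?e"
        unfolding mult'[OF X, symmetric] using X e by (intro MFunD(11)) (simp_all add: ty)
      then show ?thesis
        using X e by (simp add: ty C.comp_assoc)
    qed
    also have "At \<phi> (ObM ?L X) \<cdot>\<^bsub>C\<^esub> ArM ?T (At (Mult L) X) =
        ArM ?L (At (Mult L) X) \<cdot>\<^bsub>C\<^esub> At \<phi> (ObM ?L (ObM ?L X))"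
      using X by (intro nat) (simp_all add: ty)
    also have "At (Mult L) X \<cdot>\<^bsub>C\<^esub> (\<dots> \<cdot>\<^bsub>C\<^esub> ArM ?T ?e) =
        ?r \<cdot>\<^bsub>C\<^esub> ArM ?T ?e"
      using X by (simp add: ty C.comp_assoc)
    finally have eq: "?l \<cdot>\<^bsub>C\<^esub> ArM ?T ?e = ?r \<cdot>\<^bsub>C\<^esub> ArM ?T ?e" .
    \<comment> \<open>The threefold composite is now stripped off one factor at a time from the
      right: \<open>T T \<phi>\<close>, then \<open>T \<phi>\<close>, then \<phi>.\<close>
    have inv_TT: "ArM ?T (ArM ?T (At \<phi> X)) \<cdot>\<^bsub>C\<^esub> ArM ?T (ArM ?T (At \<psi> X)) =
        Ident C (ObM ?T (ObM ?T (ObM ?L X)))"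
      using X by (intro map_inverse[of _ _ "ObM ?T (ObM ?L X)"] map_inverse[of _ _ "ObM ?L X"])
        (simp_all add: inv' ty)
    have l: "?l \<in> Arr C" "Dom C ?l = ObM ?T (ObM ?L (ObM ?L X))"
      and r: "?r \<in> Arr C" "Dom C ?r = ObM ?T (ObM ?L (ObM ?L X))"
      using X by (simp_all add: ty)
    have split: "k \<cdot>\<^bsub>C\<^esub> ArM ?T ?e = (k \<cdot>\<^bsub>C\<^esub> ArM ?T (At \<phi> (ObM ?L X))) \<cdot>\<^bsub>C\<^esub> ArM ?T (ArM ?T (At \<phi> X))"
      if "k \<in> Arr C" "Dom C k = ObM ?T (ObM ?L (ObM ?L X))" for k
      using X that by (simp add: MFunD(11) ty C.comp_assoc)
    have "?l \<cdot>\<^bsub>C\<^esub> ArM ?T (At \<phi> (ObM ?L X)) = ?r \<cdot>\<^bsub>C\<^esub> ArM ?T (At \<phi> (ObM ?L X))"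
      by (rule cancel[OF eq[unfolded split[OF l] split[OF r]], of "ArM ?T (ArM ?T (At \<psi> X))"])
        (use X l r inv_TT in \<open>simp_all add: ty\<close>)
    from cancel_T_phi[OF this] have "?l = ?r"
      using X l r by (simp add: ty)
    from cancel_phi[OF this] show ?thesis
      using X by (simp add: ty)
  qed
  show ?thesis
    unfolding monad_on_def
  proof (intro conjI L uL mL)
    have L1: "Unit L \<triangleleft> ?L \<in> Nat ?L (?L \<circ>\<^sub>F ?L)" and L2: "?L \<triangleright> Unit L \<in> Nat ?L (?L \<circ>\<^sub>F ?L)"
      using whisker_right_Nat[OF uL id_Fun L] whisker_left_Nat[OF uL id_Fun L]
      by (simp_all add: fcomp_id_left[OF L] fcomp_id_right[OF L])
    have M1: "Mult L \<triangleleft> ?L \<in> Nat (?L \<circ>\<^sub>F ?L \<circ>\<^sub>F ?L) (?L \<circ>\<^sub>F ?L)"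
      and M2: "?L \<triangleright> Mult L \<in> Nat (?L \<circ>\<^sub>F ?L \<circ>\<^sub>F ?L) (?L \<circ>\<^sub>F ?L)"
      using whisker_right_Nat[OF mL LL L] whisker_left_Nat[OF mL LL L]
      by (simp_all add: fcomp_assoc[OF L L])
    show "Mult L \<bullet> Unit L \<triangleleft> ?L = id_nat ?L"
      by (rule Nat_eqI[OF vcomp_Nat[OF L1 mL L] id_nat_Nat[OF L] L]) (simp add: ty 1)
    show "Mult L \<bullet> ?L \<triangleright> Unit L = id_nat ?L"
      by (rule Nat_eqI[OF vcomp_Nat[OF L2 mL L] id_nat_Nat[OF L] L]) (simp add: ty 2)
    show "Mult L \<bullet> Mult L \<triangleleft> ?L = Mult L \<bullet> ?L \<triangleright> Mult L"
      by (rule Nat_eqI[OF vcomp_Nat[OF M1 mL fcomp_Fun[OF L LL]] vcomp_Nat[OF M2 mL fcomp_Fun[OF L LL]]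
            fcomp_Fun[OF L LL]]) (simp add: ty 3)
  qed
qed

section \<open>Cartesian natural transformations\<close>

lemma whisker_left_fcomp:
  assumes "\<tau> \<in> Nat F G" "F \<in> Fun A B" "H \<in> Fun B C" "K \<in> Fun C D"
  shows "(K \<circ>\<^sub>F H) \<triangleright> \<tau> = K \<triangleright> (H \<triangleright> \<tau>)"
proof -
  note t = NatD[OF assms(1,2)]
  have "K \<triangleright> (H \<triangleright> \<tau>) \<in> Nat (K \<circ>\<^sub>F H \<circ>\<^sub>F F) (K \<circ>\<^sub>F H \<circ>\<^sub>F G)"
    using whisker_left_Nat[OF whisker_left_Nat[OF assms(1-3)] fcomp_Fun[OF assms(2,3)] assms(4)]
    by (simp add: fcomp_assoc[OF assms(2,3)] fcomp_assoc[OF t(1) assms(3)])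
  then show ?thesis
    by (intro Nat_eqI[OF whisker_left_Nat[OF assms(1,2) fcomp_Fun[OF assms(3,4)]] _
        fcomp_Fun[OF assms(2) fcomp_Fun[OF assms(3,4)]]])
      (simp_all add: t(2-) FunD[OF assms(2)] FunD[OF assms(3)])
qed

lemma whisker_left_whisker_right:
  assumes "\<tau> \<in> Nat F G" "F \<in> Fun B C" "H \<in> Fun A B" "K \<in> Fun C D"
  shows "(K \<triangleright> \<tau>) \<triangleleft> H = K \<triangleright> (\<tau> \<triangleleft> H)"
proof -
  note t = NatD[OF assms(1,2)]
  have "K \<triangleright> (\<tau> \<triangleleft> H) \<in> Nat (K \<circ>\<^sub>F F \<circ>\<^sub>F H) (K \<circ>\<^sub>F G \<circ>\<^sub>F H)"
    using whisker_left_Nat[OF whisker_right_Nat[OF assms(1-3)] fcomp_Fun[OF assms(3,2)] assms(4)]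
    by (simp add: fcomp_assoc[OF assms(3,2)] fcomp_assoc[OF assms(3) t(1)])
  then show ?thesis
    by (intro Nat_eqI[OF whisker_right_Nat[OF whisker_left_Nat[OF assms(1,2,4)] fcomp_Fun[OF assms(2,4)]
          assms(3)] _ fcomp_Fun[OF assms(3) fcomp_Fun[OF assms(2,4)]]])
      (simp_all add: t(2-) FunD[OF assms(2)] FunD[OF assms(3)])
qed

section \<open>Cartesian arrows for postcomposition with \<open>p\<close>\<close>

lemma functor_category_sel [simp]:
  "Obj (functor_category A B) = Fun A B"
  "Dom (functor_category A B) = NSrc" "Cod (functor_category A B) = NTgt"
  "Ident (functor_category A B) = id_nat" "\<beta> \<cdot>\<^bsub>functor_category A B\<^esub> \<alpha> = \<beta> \<bullet> \<alpha>"
  by (simp_all add: functor_category_def)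

lemma Arr_functor_category:
  "\<tau> \<in> Arr (functor_category A B) \<longleftrightarrow>
    \<tau> \<in> Nat (NSrc \<tau>) (NTgt \<tau>) \<and> NSrc \<tau> \<in> Fun A B \<and> NTgt \<tau> \<in> Fun A B"
  by (auto simp: functor_category_def Nat_def)

lemma Nat_Arr_functor_category:
  assumes "\<tau> \<in> Nat F G" "F \<in> Fun A B"
  shows "\<tau> \<in> Arr (functor_category A B)"
  using NatD(1-3)[OF assms] assms by (simp add: Arr_functor_category)

text \<open>In \<open>cartesian\<close> the endpoints of arrows are read off the records. Here they
  are named functors, so that lifting problems can be posed and solved with the rules for
  \<open>Nat\<close>.\<close>

lemma cartesian_postcomp_iff:
  assumes p: "p \<in> Fun B C" and L: "L \<in> Fun A B" and M: "M \<in> Fun A B" and s: "\<sigma> \<in> Nat L M"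
  shows "cartesian (postcomp_functor A p) \<sigma> \<longleftrightarrow>
    (\<forall>H\<in>Fun A B. \<forall>\<gamma>\<in>Nat H M. \<forall>\<chi>\<in>Nat (p \<circ>\<^sub>F H) (p \<circ>\<^sub>F L). p \<triangleright> \<sigma> \<bullet> \<chi> = p \<triangleright> \<gamma> \<longrightarrow>
      (\<exists>!\<kappa>. \<kappa> \<in> Nat H L \<and> p \<triangleright> \<kappa> = \<chi> \<and> \<sigma> \<bullet> \<kappa> = \<gamma>))" (is "?cart \<longleftrightarrow> ?rhs")
proof -
  let ?P = "postcomp_functor A p"
  note s' = NatD[OF s L] and p' = FunD[OF p]
  have P: "Src ?P = functor_category A B" "Tgt ?P = functor_category A C"
    "\<And>H. H \<in> Fun A B \<Longrightarrow> ObM ?P H = p \<circ>\<^sub>F H"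
    "\<And>\<tau>. \<tau> \<in> Arr (functor_category A B) \<Longrightarrow> ArM ?P \<tau> = p \<triangleright> \<tau>"
    by (simp_all add: postcomp_functor_def p')
  have Nat_iff: "\<kappa> \<in> Nat F G \<longleftrightarrow> \<kappa> \<in> Arr (functor_category A X) \<and> NSrc \<kappa> = F \<and> NTgt \<kappa> = G"
    if "F \<in> Fun A X" "G \<in> Fun A X" for F G \<kappa> and X :: "('x, 'y) cat"
    using that by (auto simp: Arr_functor_category Nat_def)
  have ex1: "(\<exists>!\<kappa>. \<kappa> \<in> Arr (functor_category A B) \<and> NSrc \<kappa> = H \<and> NTgt \<kappa> = L \<and> ArM ?P \<kappa> = \<chi> \<and> \<sigma> \<bullet> \<kappa> = \<gamma>)
      \<longleftrightarrow> (\<exists>!\<kappa>. \<kappa> \<in> Nat H L \<and> p \<triangleright> \<kappa> = \<chi> \<and> \<sigma> \<bullet> \<kappa> = \<gamma>)" if "H \<in> Fun A B" for H \<chi> \<gamma>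
  proof -
    have "(\<kappa> \<in> Arr (functor_category A B) \<and> NSrc \<kappa> = H \<and> NTgt \<kappa> = L \<and> ArM ?P \<kappa> = \<chi> \<and> \<sigma> \<bullet> \<kappa> = \<gamma>)
      \<longleftrightarrow> (\<kappa> \<in> Nat H L \<and> p \<triangleright> \<kappa> = \<chi> \<and> \<sigma> \<bullet> \<kappa> = \<gamma>)" for \<kappa>
      using P(4) by (auto simp: Nat_iff[OF that L])
    then show ?thesis by simp
  qed
  have sA: "\<sigma> \<in> Arr (functor_category A B)" by (rule Nat_Arr_functor_category[OF s L])
  show ?thesis
  proof
    assume c: ?cart
    show ?rhs
    proof (intro ballI impI)
      fix H \<gamma> \<chi> assume H: "H \<in> Fun A B" and g: "\<gamma> \<in> Nat H M" and h: "\<chi> \<in> Nat (p \<circ>\<^sub>F H) (p \<circ>\<^sub>F L)"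
        and eq: "p \<triangleright> \<sigma> \<bullet> \<chi> = p \<triangleright> \<gamma>"
      note g' = NatD[OF g H] and h' = NatD[OF h fcomp_Fun[OF H p]]
      have gA: "\<gamma> \<in> Arr (functor_category A B)" by (rule Nat_Arr_functor_category[OF g H])
      have hA: "\<chi> \<in> Arr (functor_category A C)"
        by (rule Nat_Arr_functor_category[OF h fcomp_Fun[OF H p]])
      have "\<exists>!\<kappa>. \<kappa> \<in> Arr (functor_category A B) \<and> NSrc \<kappa> = H \<and> NTgt \<kappa> = L \<and> ArM ?P \<kappa> = \<chi> \<and> \<sigma> \<bullet> \<kappa> = \<gamma>"
        using bspec[OF bspec[OF conjunct2[OF c[unfolded cartesian_def P]] gA] hA]
        by (simp add: P H L gA sA eq g'(2,3) h'(2,3) s'(2,3))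
      then show "\<exists>!\<kappa>. \<kappa> \<in> Nat H L \<and> p \<triangleright> \<kappa> = \<chi> \<and> \<sigma> \<bullet> \<kappa> = \<gamma>" by (simp add: ex1[OF H])
    qed
  next
    assume r: ?rhs
    show ?cart
      unfolding cartesian_def P
    proof (intro conjI ballI impI sA)
      fix \<gamma> \<chi> assume gA: "\<gamma> \<in> Arr (functor_category A B)" and hA: "\<chi> \<in> Arr (functor_category A C)"
        and *: "Cod (functor_category A B) \<gamma> = Cod (functor_category A B) \<sigma> \<and>
          Dom (functor_category A C) \<chi> = ObM ?P (Dom (functor_category A B) \<gamma>) \<and>
          Cod (functor_category A C) \<chi> = ObM ?P (Dom (functor_category A B) \<sigma>) \<and>
          ArM ?P \<sigma> \<cdot>\<^bsub>functor_category A C\<^esub> \<chi> = ArM ?P \<gamma>"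
      from gA have H: "NSrc \<gamma> \<in> Fun A B" by (simp add: Arr_functor_category)
      have *: "\<gamma> \<in> Nat (NSrc \<gamma>) M" "\<chi> \<in> Nat (p \<circ>\<^sub>F NSrc \<gamma>) (p \<circ>\<^sub>F L)" "p \<triangleright> \<sigma> \<bullet> \<chi> = p \<triangleright> \<gamma>"
        using gA hA * H L sA s'(2,3) by (auto simp: Arr_functor_category P)
      have "\<exists>!\<kappa>. \<kappa> \<in> Nat (NSrc \<gamma>) L \<and> p \<triangleright> \<kappa> = \<chi> \<and> \<sigma> \<bullet> \<kappa> = \<gamma>"
        by (rule r[rule_format, OF H *])
      then show "\<exists>!\<kappa>. \<kappa> \<in> Arr (functor_category A B) \<and>
          Dom (functor_category A B) \<kappa> = Dom (functor_category A B) \<gamma> \<and>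
          Cod (functor_category A B) \<kappa> = Dom (functor_category A B) \<sigma> \<and>
          ArM ?P \<kappa> = \<chi> \<and> \<sigma> \<cdot>\<^bsub>functor_category A B\<^esub> \<kappa> = \<gamma>"
        by (simp add: ex1[OF H] s'(2))
    qed
  qed
qed

lemma cartesian_postcomp_id_nat:
  assumes "p \<in> Fun B C" "L \<in> Fun A B"
  shows "cartesian (postcomp_functor A p) (id_nat L)"
  unfolding cartesian_postcomp_iff[OF assms(1,2,2) id_nat_Nat[OF assms(2)]]
proof (intro ballI impI)
  fix H \<gamma> \<chi> assume H: "H \<in> Fun A B" and g: "\<gamma> \<in> Nat H L" and h: "\<chi> \<in> Nat (p \<circ>\<^sub>F H) (p \<circ>\<^sub>F L)"
    and eq: "p \<triangleright> id_nat L \<bullet> \<chi> = p \<triangleright> \<gamma>"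
  have "\<chi> = p \<triangleright> \<gamma>"
    using eq by (simp add: whisker_left_id[OF assms(2,1)] vcomp_id_left[OF h fcomp_Fun[OF H assms(1)]])
  show "\<exists>!\<kappa>. \<kappa> \<in> Nat H L \<and> p \<triangleright> \<kappa> = \<chi> \<and> id_nat L \<bullet> \<kappa> = \<gamma>"
  proof (rule ex1I)
    show "\<gamma> \<in> Nat H L \<and> p \<triangleright> \<gamma> = \<chi> \<and> id_nat L \<bullet> \<gamma> = \<gamma>"
      by (simp add: g \<open>\<chi> = p \<triangleright> \<gamma>\<close> vcomp_id_left[OF g H])
    fix \<kappa> assume "\<kappa> \<in> Nat H L \<and> p \<triangleright> \<kappa> = \<chi> \<and> id_nat L \<bullet> \<kappa> = \<gamma>"
    then show "\<kappa> = \<gamma>" using vcomp_id_left[of \<kappa> H L, OF _ H] by simp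
  qed
qed

text \<open>Two transformations with the same image under \<open>p\<close> and the same composite
  with \<sigma> solve one lifting problem. This is how equations between transformations into
  \<open>MFun L\<close> are proved later.\<close>

lemma cartesian_postcomp_cancel:
  assumes cart: "cartesian (postcomp_functor A p) \<sigma>"
    and p: "p \<in> Fun B C" and L: "L \<in> Fun A B" and M: "M \<in> Fun A B" and s: "\<sigma> \<in> Nat L M"
    and H: "H \<in> Fun A B" and k: "\<kappa> \<in> Nat H L" "\<kappa>' \<in> Nat H L"
    and eq: "p \<triangleright> \<kappa> = p \<triangleright> \<kappa>'" "\<sigma> \<bullet> \<kappa> = \<sigma> \<bullet> \<kappa>'"
  shows "\<kappa> = \<kappa>'"
proof -
  have "\<exists>!k. k \<in> Nat H L \<and> p \<triangleright> k = p \<triangleright> \<kappa> \<and> \<sigma> \<bullet> k = \<sigma> \<bullet> \<kappa>"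
    by (rule cart[unfolded cartesian_postcomp_iff[OF p L M s], rule_format, OF H vcomp_Nat[OF k(1) s H]
          whisker_left_Nat[OF k(1) H p] whisker_left_vcomp[OF k(1) s H p, symmetric]])
  from the1_equality[OF this, of \<kappa>] the1_equality[OF this, of \<kappa>'] k eq show ?thesis by simp
qed


section \<open>The codensity presentation of a lifting\<close>

text \<open>Meant for \<open>D\<close> lifting \<open>T\<close>: an arrow into \<open>D Y\<close> is
  then sent by \<open>p\<close> to an arrow into \<open>T (p Y)\<close>, so the resulting pair is
  again a Kleisli arrow.\<close>

definition kleisli_map ::
  "('oe, 'me, 'ob, 'mb) cfunctor \<Rightarrow> ('ob, 'mb) mnd \<Rightarrow> ('oe, 'me) mnd \<Rightarrow>
    ('oe, 'me \<times> 'oe, 'ob, 'mb \<times> 'ob) cfunctor" where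
  "kleisli_map p T D = \<lparr>Src = kleisli D, Tgt = kleisli T,
     ObM = (\<lambda>X\<in>Obj (kleisli D). ObM p X),
     ArM = (\<lambda>x\<in>Arr (kleisli D). (ArM p (fst x), ObM p (snd x)))\<rparr>"

locale lifted_monad = T: monad B T + D: monad E D
  for B :: "('ob, 'mb) cat" and T :: "('ob, 'mb) mnd"
    and E :: "('oe, 'me) cat" and D :: "('oe, 'me) mnd" +
  fixes p :: "('oe, 'me, 'ob, 'mb) cfunctor"
  assumes p: "p \<in> Fun E B" and lifting: "monad_lifting p T D"
begin

lemmas pD = FunD[OF p]

lemma p_MFun: "p \<circ>\<^sub>F MFun D = MFun T \<circ>\<^sub>F p"
  and p_Unit: "p \<triangleright> Unit D = Unit T \<triangleleft> p"
  and p_Mult: "p \<triangleright> Mult D = Mult T \<triangleleft> p"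
  using lifting by (auto simp: monad_lifting_def)

lemma p_sel:
  "X \<in> Obj E \<Longrightarrow> ObM p (ObM (MFun D) X) = ObM (MFun T) (ObM p X)"
  "f \<in> Arr E \<Longrightarrow> ArM p (ArM (MFun D) f) = ArM (MFun T) (ArM p f)"
  "X \<in> Obj E \<Longrightarrow> ArM p (At (Unit D) X) = At (Unit T) (ObM p X)"
  "X \<in> Obj E \<Longrightarrow> ArM p (At (Mult D) X) = At (Mult T) (ObM p X)"
  using arg_cong[OF p_MFun, of "\<lambda>F. ObM F X"] arg_cong[OF p_MFun, of "\<lambda>F. ArM F f"]
    arg_cong[OF p_Unit, of "\<lambda>\<tau>. At \<tau> X"] arg_cong[OF p_Mult, of "\<lambda>\<tau>. At \<tau> X"]
  by (simp_all add: D.typing pD)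

section \<open>The lifting parameter and its Kan extension\<close>

abbreviation "S \<equiv> kleisli_K D"
abbreviation "R \<equiv> kleisli_map p T D"
abbreviation "c \<equiv> kleisli_K D \<triangleright> kleisli_counit D"

lemmas S = D.kleisli_K_Fun

lemma kleisli_map_sel [simp]:
  "Src R = kleisli D" "Tgt R = kleisli T"
  "X \<in> Obj E \<Longrightarrow> ObM R X = ObM p X"
  "(f, Y) \<in> Arr (kleisli D) \<Longrightarrow> ArM R (f, Y) = (ArM p f, ObM p Y)"
  by (simp_all add: kleisli_map_def)

text \<open>Identities are preserved because \<open>p\<close> respects the units, composites because
  it respects the endofunctors and multiplications.\<close>

lemma kleisli_map_Fun: "R \<in> Fun (kleisli D) (kleisli T)"
proof -
  have "ObM R \<in> extensional (Obj E)" "ArM R \<in> extensional (Arr (kleisli D))"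
    by (simp_all add: kleisli_map_def)
  then show ?thesis
    by (auto simp: Fun_def is_functor_def PiE_def D.kleisli_category T.kleisli_category D.typing pD p_sel)
qed

lemma K_kleisli_map: "kleisli_K T \<circ>\<^sub>F R = p \<circ>\<^sub>F S"
  by (rule Fun_eqI[OF fcomp_Fun[OF kleisli_map_Fun T.kleisli_K_Fun] fcomp_Fun[OF S p]])
    (auto simp: D.typing pD p_sel)

lemma is_ran_S: "is_ran S S (MFun D) c"
  using D.is_ran_kleisli_K[OF S] by (simp add: D.kleisli_K_J)

lemmas ranD = is_ranD[OF is_ran_S S S]

text \<open>The image of the extension under \<open>p\<close> is, as a record, the extension of
  \<open>p S\<close> along \<open>S\<close> supplied by the adjunction.\<close>

lemma preserves_ran_S: "preserves_ran p S S (MFun D) c"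
proof -
  have "p \<circ>\<^sub>F S \<circ>\<^sub>F kleisli_J D = p \<circ>\<^sub>F MFun D"
    by (simp add: D.kleisli_K_J flip: fcomp_assoc[OF D.kleisli_J_Fun S])
  moreover have "(p \<circ>\<^sub>F S) \<triangleright> kleisli_counit D = p \<triangleright> c"
    by (rule whisker_left_fcomp[OF D.kleisli_counit_Nat fcomp_Fun[OF S D.kleisli_J_Fun] S p])
  ultimately show ?thesis
    using D.is_ran_kleisli_K[OF fcomp_Fun[OF S p]] by (simp add: preserves_ran_def)
qed

lemma At_c: "X \<in> Obj E \<Longrightarrow> At c X = At (Mult D) X"
  using D.kleisli_K_counit[of X] by simp

text \<open>At \<open>X\<close> either side is the multiplication of \<open>T\<close> at
  \<open>p X\<close>, since the multiplication of \<open>D\<close> lies above it.\<close>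

lemma K_counit_R: "kleisli_K T \<triangleright> kleisli_counit T \<triangleleft> R = p \<triangleright> c"
proof -
  note KR = fcomp_Fun[OF kleisli_map_Fun T.kleisli_K_Fun]
  have "kleisli_counit T \<triangleleft> R \<in> Nat (kleisli_J T \<circ>\<^sub>F (kleisli_K T \<circ>\<^sub>F R)) R"
    using whisker_right_Nat[OF T.kleisli_counit_Nat fcomp_Fun[OF T.kleisli_K_Fun T.kleisli_J_Fun]
        kleisli_map_Fun]
    by (simp add: fcomp_id_left[OF kleisli_map_Fun] fcomp_assoc[OF kleisli_map_Fun T.kleisli_K_Fun])
  from whisker_left_Nat[OF this fcomp_Fun[OF KR T.kleisli_J_Fun] T.kleisli_K_Fun]
  have 1: "kleisli_K T \<triangleright> kleisli_counit T \<triangleleft> R \<in> Nat (MFun T \<circ>\<^sub>F (p \<circ>\<^sub>F S)) (p \<circ>\<^sub>F S)"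
    by (simp add: fcomp_assoc[OF KR T.kleisli_J_Fun] T.kleisli_K_J K_kleisli_map
        fcomp_assoc[OF fcomp_Fun[OF S p] T.kleisli_J_Fun])
  have 2: "p \<triangleright> c \<in> Nat (MFun T \<circ>\<^sub>F (p \<circ>\<^sub>F S)) (p \<circ>\<^sub>F S)"
    using whisker_left_Nat[OF ranD(2) fcomp_Fun[OF S D.MFun] p]
    by (simp add: fcomp_assoc[OF S D.MFun] fcomp_assoc[OF S p] p_MFun)
  show ?thesis
  proof (rule Nat_eqI[OF 1 2 fcomp_Fun[OF fcomp_Fun[OF S p] T.MFun]])
    fix X assume "X \<in> Obj (kleisli D)"
    then have X: "X \<in> Obj E" by simp
    have "At (kleisli_K T \<triangleright> kleisli_counit T \<triangleleft> R) X = At (Mult T) (ObM p X)"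
      using X T.kleisli_K_counit[of "ObM p X"] by (simp add: pD)
    also have "\<dots> = At (p \<triangleright> c) X"
      using X At_c[OF X] by (simp add: p_sel)
    finally show "At (kleisli_K T \<triangleright> kleisli_counit T \<triangleleft> R) X = At (p \<triangleright> c) X" .
  qed
qed

text \<open>Applying \<open>p\<close> to the equation that defines \<theta> shows that
  \<open>p \<theta>\<close> solves the equation defining the transpose, whose solution is unique
  because \<open>p\<close> preserves the extension.\<close>

lemma ran_transpose_eq:
  assumes r: "is_ran S S Q d" and pr: "preserves_ran p S S Q d"
    and t: "\<theta> \<in> Nat (MFun D) Q" "d \<bullet> \<theta> \<triangleleft> S = c"
  shows "ran_transpose p S Q d (MFun T \<circ>\<^sub>F p) (kleisli_K T \<triangleright> kleisli_counit T \<triangleleft> R) = p \<triangleright> \<theta>"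
proof -
  note r' = is_ranD[OF r S S]
  note pr' = is_ranD[OF pr[unfolded preserves_ran_def] S fcomp_Fun[OF S p]]
  have th: "p \<triangleright> \<theta> \<in> Nat (MFun T \<circ>\<^sub>F p) (p \<circ>\<^sub>F Q)"
    using whisker_left_Nat[OF t(1) D.MFun p] by (simp add: p_MFun)
  have "p \<triangleright> d \<bullet> (p \<triangleright> \<theta>) \<triangleleft> S = p \<triangleright> c"
    using whisker_left_vcomp[OF whisker_right_Nat[OF t(1) D.MFun S] r'(2) fcomp_Fun[OF S D.MFun] p]
    by (simp add: t(2) whisker_left_whisker_right[OF t(1) D.MFun S p])
  moreover have "p \<triangleright> c \<in> Nat (MFun T \<circ>\<^sub>F p \<circ>\<^sub>F S) (p \<circ>\<^sub>F S)"
    using whisker_left_Nat[OF ranD(2) fcomp_Fun[OF S D.MFun] p]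
    by (simp add: fcomp_assoc[OF S D.MFun] p_MFun)
  ultimately show ?thesis
    unfolding ran_transpose_def K_counit_R
    using pr'(3)[OF fcomp_Fun[OF p T.MFun]] th by (intro the1_equality) auto
qed

text \<open>The components of \<open>c\<close> are multiplications, so the equation characterizing
  the codensity unit is the unit law of \<open>D\<close>, carried over to \<open>Q\<close> by
  \<theta>.\<close>

lemma codensity_unit_eq:
  assumes r: "is_ran S S Q d" and t: "\<theta> \<in> Nat (MFun D) Q" "d \<bullet> \<theta> \<triangleleft> S = c"
  shows "codensity_unit S Q d = \<theta> \<bullet> Unit D"
proof -
  note r' = is_ranD[OF r S S] and s' = FunD[OF S]
  have idS: "id_nat S \<in> Nat (id_functor E \<circ>\<^sub>F S) S"
    using id_nat_Nat[OF S] by (simp add: fcomp_id_left[OF S])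
  have u: "Unit D \<triangleleft> S \<in> Nat S (MFun D \<circ>\<^sub>F S)"
    using whisker_right_Nat[OF D.Unit D.id_Fun S] by (simp add: fcomp_id_left[OF S])
  have th: "\<theta> \<bullet> Unit D \<in> Nat (id_functor E) Q"
    by (rule vcomp_Nat[OF D.Unit t(1) D.id_Fun])
  have "d \<bullet> (\<theta> \<bullet> Unit D) \<triangleleft> S = d \<bullet> \<theta> \<triangleleft> S \<bullet> Unit D \<triangleleft> S"
    by (simp add: whisker_right_vcomp[OF D.Unit t(1) D.id_Fun S]
        vcomp_assoc[OF u whisker_right_Nat[OF t(1) D.MFun S] r'(2) S])
  also have "\<dots> = id_nat S"
    unfolding t(2)
  proof (rule Nat_eqI[OF vcomp_Nat[OF u ranD(2) S] id_nat_Nat[OF S] S])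
    fix X assume "X \<in> Obj (kleisli D)"
    then show "At (c \<bullet> Unit D \<triangleleft> S) X = At (id_nat S) X"
      using At_c[of X] D.mult_unit[of X] by (simp add: D.typing)
  qed
  finally show ?thesis
    unfolding codensity_unit_def s'
    using r'(3)[OF D.id_Fun idS] th by (intro the1_equality) auto
qed

text \<open>The comparison \<open>\<theta>\<close> is a morphism of monads from \<open>D\<close> to the codensity monad.\<close>
lemma codensity_mult_eq:
  assumes r: "is_ran S S Q d" and t: "\<theta> \<in> Nat (MFun D) Q" "d \<bullet> \<theta> \<triangleleft> S = c"
  shows "codensity_mult S Q d \<in> Nat (Q \<circ>\<^sub>F Q) Q"
    and "codensity_mult S Q d \<bullet> \<theta> \<triangleleft> Q \<bullet> MFun D \<triangleright> \<theta> = \<theta> \<bullet> Mult D"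
proof -
  let ?m = "codensity_mult S Q d"
  note r' = is_ranD[OF r S S] and S' = FunD[OF S]
  note Q = r'(1)
  note QQ = fcomp_Fun[OF Q Q] and QS = fcomp_Fun[OF S Q]
  have "d \<bullet> Q \<triangleright> d \<in> Nat (Q \<circ>\<^sub>F Q \<circ>\<^sub>F S) S"
    using vcomp_Nat[OF whisker_left_Nat[OF r'(2) QS Q] r'(2) fcomp_Fun[OF QS Q]]
    by (simp add: fcomp_assoc[OF S Q])
  from theI'[OF r'(3)[OF QQ this]]
  have m: "?m \<in> Nat (Q \<circ>\<^sub>F Q) Q" "d \<bullet> ?m \<triangleleft> S = d \<bullet> Q \<triangleright> d"
    unfolding codensity_mult_def by auto
  then show "?m \<in> Nat (Q \<circ>\<^sub>F Q) Q" by simp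
  note q' = FunD[OF Q] and m' = NatD[OF m(1) QQ] and t' = NatD[OF t(1) D.MFun] and d' = NatD[OF r'(2) QS]
  note ty = D.typing q'(4-10) m'(2,3,5-7) t'(2,3,5-7) d'(2,3,5-7)
  have md: "At d X \<cdot>\<^bsub>E\<^esub> At ?m (ObM S X) = At d X \<cdot>\<^bsub>E\<^esub> ArM Q (At d X)" if "X \<in> Obj E" for X
    using arg_cong[OF m(2), of "\<lambda>\<tau>. At \<tau> X"] that by (simp add: ty)
  have td: "At d X \<cdot>\<^bsub>E\<^esub> At \<theta> (ObM S X) = At (Mult D) X" if "X \<in> Obj E" for X
    using arg_cong[OF t(2), of "\<lambda>\<tau>. At \<tau> X"] that At_c[OF that] by (simp add: ty)
  let ?n = "?m \<bullet> \<theta> \<triangleleft> Q \<bullet> MFun D \<triangleright> \<theta>" and ?n' = "\<theta> \<bullet> Mult D"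
  have n: "?n \<in> Nat (MFun D \<circ>\<^sub>F MFun D) Q"
    by (rule vcomp_Nat[OF whisker_left_Nat[OF t(1) D.MFun D.MFun]
          vcomp_Nat[OF whisker_right_Nat[OF t(1) D.MFun Q] m(1) fcomp_Fun[OF Q D.MFun]] D.TT_Fun])
  have n': "?n' \<in> Nat (MFun D \<circ>\<^sub>F MFun D) Q"
    by (rule vcomp_Nat[OF D.Mult t(1) D.TT_Fun])
  note DDS = fcomp_Fun[OF S D.TT_Fun]
  have nS: "d \<bullet> ?n \<triangleleft> S \<in> Nat (MFun D \<circ>\<^sub>F MFun D \<circ>\<^sub>F S) S"
    by (rule vcomp_Nat[OF whisker_right_Nat[OF n D.TT_Fun S] r'(2) DDS])
  have nS': "d \<bullet> ?n' \<triangleleft> S \<in> Nat (MFun D \<circ>\<^sub>F MFun D \<circ>\<^sub>F S) S"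
    by (rule vcomp_Nat[OF whisker_right_Nat[OF n' D.TT_Fun S] r'(2) DDS])
  \<comment> \<open>Transformations into \<open>Q\<close> are determined by their whiskering with
    \<open>S\<close> followed by \<open>d\<close>. At \<open>X\<close>, the equations
    \<open>md\<close> and \<open>td\<close> and naturality of \<theta> at \<open>d\<close> turn the
    left side into multiplication after \<open>D\<close> of multiplication; associativity in
    \<open>D\<close> gives the right side.\<close>
  have "d \<bullet> ?n \<triangleleft> S = d \<bullet> ?n' \<triangleleft> S"
  proof (rule Nat_eqI[OF nS nS' DDS])
    fix X assume "X \<in> Obj (kleisli D)"
    then have X: "X \<in> Obj E" by simp
    let ?D = "MFun D" and ?SX = "ObM (MFun D) X"
    have "At (d \<bullet> ?n \<triangleleft> S) X =
        (At d X \<cdot>\<^bsub>E\<^esub> At ?m ?SX) \<cdot>\<^bsub>E\<^esub> (At \<theta> (ObM Q ?SX) \<cdot>\<^bsub>E\<^esub> ArM ?D (At \<theta> ?SX))"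
      using X by (simp add: ty D.C.comp_assoc)
    also have "\<dots> = At d X \<cdot>\<^bsub>E\<^esub> ((ArM Q (At d X) \<cdot>\<^bsub>E\<^esub> At \<theta> (ObM Q ?SX)) \<cdot>\<^bsub>E\<^esub> ArM ?D (At \<theta> ?SX))"
      using X md[OF X] by (simp add: ty D.C.comp_assoc)
    also have "ArM Q (At d X) \<cdot>\<^bsub>E\<^esub> At \<theta> (ObM Q ?SX) = At \<theta> ?SX \<cdot>\<^bsub>E\<^esub> ArM ?D (At d X)"
      using X Nat_naturality[OF t(1) D.MFun d'(5)[of X]] by (simp add: ty)
    also have "At d X \<cdot>\<^bsub>E\<^esub> (\<dots> \<cdot>\<^bsub>E\<^esub> ArM ?D (At \<theta> ?SX)) =
        (At d X \<cdot>\<^bsub>E\<^esub> At \<theta> ?SX) \<cdot>\<^bsub>E\<^esub> ArM ?D (At d X \<cdot>\<^bsub>E\<^esub> At \<theta> ?SX)"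
      using X by (simp add: D.MFunD(11) ty D.C.comp_assoc)
    also have "\<dots> = At (Mult D) X \<cdot>\<^bsub>E\<^esub> At (Mult D) ?SX"
      using X td[OF X] by (simp add: D.mult_assoc)
    also have "\<dots> = (At d X \<cdot>\<^bsub>E\<^esub> At \<theta> ?SX) \<cdot>\<^bsub>E\<^esub> At (Mult D) ?SX"
      using X td[OF X] by simp
    also have "\<dots> = At (d \<bullet> ?n' \<triangleleft> S) X"
      using X by (simp add: ty D.C.comp_assoc)
    finally show "At (d \<bullet> ?n \<triangleleft> S) X = At (d \<bullet> ?n' \<triangleleft> S) X" .
  qed
  then show "?n = ?n'"
    using r'(3)[OF D.TT_Fun nS'] n n' by blast
qed

text \<open>All descriptions in terms of \<theta> are specialized to the identity: the transpose
  becomes the image under \<open>p\<close> of an identity, which is cartesian, and the codensity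
  unit and multiplication become those of \<open>D\<close>.\<close>

lemma codensity_lifting_self: "codensity_lifting p T R S D"
proof -
  let ?i = "id_nat (MFun D)"
  have i: "?i \<in> Nat (MFun D) (MFun D)" "c \<bullet> ?i \<triangleleft> S = c"
    using id_nat_Nat[OF D.MFun] vcomp_id_right[OF ranD(2) fcomp_Fun[OF S D.MFun]]
    by (simp_all add: whisker_right_id[OF D.MFun S])
  have "cartesian_lifting (postcomp_functor (Src p) p)
      (ran_transpose p S (MFun D) c (MFun T \<circ>\<^sub>F p) (kleisli_K T \<triangleright> kleisli_counit T \<triangleleft> R)) (MFun D) ?i"
    unfolding cartesian_lifting_def ran_transpose_eq[OF is_ran_S preserves_ran_S i] pD(4)
    using cartesian_postcomp_id_nat[OF p D.MFun] Nat_Arr_functor_category[OF i(1) D.MFun]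
    by (simp add: postcomp_functor_def pD)
  then show ?thesis
    unfolding codensity_lifting_def
    using is_ran_S preserves_ran_S i(1) D.Unit D.Mult p_Unit p_Mult
      codensity_unit_eq[OF is_ran_S i] codensity_mult_eq(2)[OF is_ran_S i]
    by (intro exI[of _ "MFun D"] exI[of _ c] exI[of _ ?i]) (simp add: pD)
qed

lemma codensity_lifting_iso:
  assumes "codensity_lifting p T R S L"
  shows "iso_liftings p T D L"
proof -
  from assms obtain Q d \<sigma> where Q: "is_ran S S Q d" "preserves_ran p S S Q d"
    and s: "\<sigma> \<in> Nat (MFun L) Q"
    and cart: "cartesian_lifting (postcomp_functor E p)
          (ran_transpose p S Q d (MFun T \<circ>\<^sub>F p) (kleisli_K T \<triangleright> kleisli_counit T \<triangleleft> R)) Q \<sigma>"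
    and uL: "Unit L \<in> Nat (id_functor E) (MFun L)" and puL: "p \<triangleright> Unit L = Unit T \<triangleleft> p"
    and suL: "\<sigma> \<bullet> Unit L = codensity_unit S Q d"
    and mL: "Mult L \<in> Nat (MFun L \<circ>\<^sub>F MFun L) (MFun L)" and pmL: "p \<triangleright> Mult L = Mult T \<triangleleft> p"
    and smL: "\<sigma> \<bullet> Mult L = codensity_mult S Q d \<bullet> \<sigma> \<triangleleft> Q \<bullet> MFun L \<triangleright> \<sigma>"
    unfolding codensity_lifting_def pD(4) by blast
  let ?m = "codensity_mult S Q d" and ?L = "MFun L" and ?D = "MFun D"
  obtain \<theta> \<theta>' where t: "\<theta> \<in> Nat ?D Q" "\<theta>' \<in> Nat Q ?D" "d \<bullet> \<theta> \<triangleleft> S = c"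
      "\<theta>' \<bullet> \<theta> = id_nat ?D" "\<theta> \<bullet> \<theta>' = id_nat Q"
    by (rule is_ran_comparison[OF is_ran_S Q(1) S S])
  note QE = is_ranD(1)[OF Q(1) S S]
  from cart have sA: "\<sigma> \<in> Arr (functor_category E E)"
    and cart': "cartesian (postcomp_functor E p) \<sigma>"
    unfolding cartesian_lifting_def by (simp_all add: cartesian_def postcomp_functor_def pD)
  have "ArM (postcomp_functor E p) \<sigma> = p \<triangleright> \<theta>"
    using cart unfolding cartesian_lifting_def ran_transpose_eq[OF Q t(1,3)] by blast
  with sA have ps: "p \<triangleright> \<sigma> = p \<triangleright> \<theta>"
    by (simp add: postcomp_functor_def pD)
  \<comment> \<open>The typing of the functor of \<open>L\<close> is recovered from \<sigma> being
    an arrow of the functor category.\<close>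
  have LE: "?L \<in> Fun E E"
    using sA s by (auto simp: Arr_functor_category Nat_def)
  \<comment> \<open>Since \<sigma> and \<theta> have equal images under \<open>p\<close>, so do
    their source functors.\<close>
  have pL: "p \<circ>\<^sub>F ?L = MFun T \<circ>\<^sub>F p"
    using arg_cong[OF ps, of NSrc] NatD(2)[OF s LE] NatD(2)[OF t(1) D.MFun] by (simp add: p_MFun)
  note TpE = fcomp_Fun[OF p T.MFun]
  note LL = fcomp_Fun[OF LE LE]
  note cancel = cartesian_postcomp_cancel[OF cart' p LE QE s]
  have pt: "p \<triangleright> \<theta> \<in> Nat (MFun T \<circ>\<^sub>F p) (p \<circ>\<^sub>F Q)" "p \<triangleright> \<theta>' \<in> Nat (p \<circ>\<^sub>F Q) (MFun T \<circ>\<^sub>F p)"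
    using whisker_left_Nat[OF t(1) D.MFun p] whisker_left_Nat[OF t(2) QE p] by (simp_all add: p_MFun)
  \<comment> \<open>As \<sigma> and \<theta> lie above the same transformation, factoring \<theta>
    through \<sigma> over the identity is a legitimate lifting problem.\<close>
  have "\<exists>!\<kappa>. \<kappa> \<in> Nat ?D ?L \<and> p \<triangleright> \<kappa> = id_nat (MFun T \<circ>\<^sub>F p) \<and> \<sigma> \<bullet> \<kappa> = \<theta>"
    using id_nat_Nat[OF TpE] vcomp_id_right[OF pt(1) TpE]
    by (intro cart'[unfolded cartesian_postcomp_iff[OF p LE QE s], rule_format, OF D.MFun t(1)])
      (simp_all add: p_MFun pL ps)
  then obtain \<phi> where phi: "\<phi> \<in> Nat ?D ?L" and pphi: "p \<triangleright> \<phi> = id_nat (MFun T \<circ>\<^sub>F p)" and sphi: "\<sigma> \<bullet> \<phi> = \<theta>"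
    by blast
  let ?psi = "\<theta>' \<bullet> \<sigma>"
  have psi: "?psi \<in> Nat ?L ?D" by (rule vcomp_Nat[OF s t(2) LE])
  have psi_phi: "?psi \<bullet> \<phi> = id_nat ?D"
    using vcomp_assoc[OF phi s t(2) D.MFun] by (simp add: sphi t(4))
  \<comment> \<open>Under \<open>p\<close> the composite becomes \<open>p \<theta>'\<close> after
    \<open>p \<theta>\<close>, an identity; after \<sigma> it becomes \<theta> after
    \<open>\<theta>'\<close> after \<sigma>, which is \<sigma>.\<close>
  have phi_psi: "\<phi> \<bullet> ?psi = id_nat ?L"
  proof (rule cancel[OF LE vcomp_Nat[OF psi phi LE] id_nat_Nat[OF LE]])
    have "p \<triangleright> ?psi = p \<triangleright> \<theta>' \<bullet> p \<triangleright> \<theta>"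
      by (simp add: whisker_left_vcomp[OF s t(2) LE p] ps)
    also have "\<dots> = id_nat (MFun T \<circ>\<^sub>F p)"
      by (simp add: t(4) whisker_left_id[OF D.MFun p] p_MFun flip: whisker_left_vcomp[OF t(1,2) D.MFun p])
    finally show "p \<triangleright> (\<phi> \<bullet> ?psi) = p \<triangleright> id_nat ?L"
      using vcomp_id_left[OF id_nat_Nat[OF TpE] TpE]
      by (simp add: whisker_left_vcomp[OF psi phi LE p] pphi whisker_left_id[OF LE p] pL)
    have "\<sigma> \<bullet> (\<phi> \<bullet> ?psi) = \<theta> \<bullet> (\<theta>' \<bullet> \<sigma>)"
      by (simp add: sphi flip: vcomp_assoc[OF psi phi s LE])
    also have "\<dots> = \<sigma>"
      by (simp add: t(5) vcomp_id_left[OF s LE] flip: vcomp_assoc[OF s t(2,1) LE])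
    finally show "\<sigma> \<bullet> (\<phi> \<bullet> ?psi) = \<sigma> \<bullet> id_nat ?L"
      by (simp add: vcomp_id_right[OF s LE])
  qed
  note ph' = NatD[OF phi D.MFun] and s' = NatD[OF s LE] and l = FunD[OF LE]
  have iso: "iso_arr (functor_category E E) \<phi>"
    unfolding iso_arr_def
    using Nat_Arr_functor_category[OF phi D.MFun] Nat_Arr_functor_category[OF psi LE]
      NatD(2,3)[OF psi LE] ph'(2,3) psi_phi phi_psi
    by (auto intro!: bexI[of _ ?psi])
  have unit: "\<phi> \<bullet> Unit D = Unit L"
  proof (rule cancel[OF D.id_Fun vcomp_Nat[OF D.Unit phi D.id_Fun] uL])
    have "Unit T \<triangleleft> p \<in> Nat p (MFun T \<circ>\<^sub>F p)"
      using whisker_right_Nat[OF T.Unit T.id_Fun p] by (simp add: fcomp_id_left[OF p])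
    then show "p \<triangleright> (\<phi> \<bullet> Unit D) = p \<triangleright> Unit L"
      using vcomp_id_left[of "Unit T \<triangleleft> p", OF _ p]
      by (simp add: whisker_left_vcomp[OF D.Unit phi D.id_Fun p] pphi p_Unit puL)
    show "\<sigma> \<bullet> (\<phi> \<bullet> Unit D) = \<sigma> \<bullet> Unit L"
      by (simp add: suL codensity_unit_eq[OF Q(1) t(1,3)] sphi flip: vcomp_assoc[OF D.Unit phi s D.id_Fun])
  qed
  have mult: "\<phi> \<bullet> Mult D = Mult L \<bullet> \<phi> \<triangleleft> ?L \<bullet> ?D \<triangleright> \<phi>" (is "?l = ?r")
  proof (rule cancel[OF D.TT_Fun vcomp_Nat[OF D.Mult phi D.TT_Fun]])
    note DL = fcomp_Fun[OF LE D.MFun]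
    note phL = whisker_right_Nat[OF phi D.MFun LE] and Dph = whisker_left_Nat[OF phi D.MFun D.MFun]
    note mph = vcomp_Nat[OF phL mL DL]
    show r: "?r \<in> Nat (?D \<circ>\<^sub>F ?D) ?L"
      by (rule vcomp_Nat[OF Dph mph D.TT_Fun])
    have TT: "MFun T \<circ>\<^sub>F MFun T \<circ>\<^sub>F p = MFun T \<circ>\<^sub>F p \<circ>\<^sub>F ?D"
      by (simp add: p_MFun flip: fcomp_assoc[OF p T.MFun] fcomp_assoc[OF D.MFun p])
    have pL2: "MFun T \<circ>\<^sub>F p \<circ>\<^sub>F ?L = MFun T \<circ>\<^sub>F MFun T \<circ>\<^sub>F p"
      by (simp add: pL flip: fcomp_assoc[OF p T.MFun] fcomp_assoc[OF LE p])
    have TTp: "MFun T \<circ>\<^sub>F MFun T \<circ>\<^sub>F p \<in> Fun E B"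
      by (rule fcomp_Fun[OF p T.TT_Fun])
    have mTp: "Mult T \<triangleleft> p \<in> Nat (MFun T \<circ>\<^sub>F MFun T \<circ>\<^sub>F p) (MFun T \<circ>\<^sub>F p)"
      by (rule whisker_right_Nat[OF T.Mult T.TT_Fun p])
    \<comment> \<open>Since \<phi> is vertical, both of its whiskerings become identities under
      \<open>p\<close>, and only the multiplication of \<open>T\<close> at \<open>p\<close>
      remains.\<close>
    have "p \<triangleright> (\<phi> \<triangleleft> ?L) = id_nat (MFun T \<circ>\<^sub>F MFun T \<circ>\<^sub>F p)"
      by (simp add: pphi whisker_right_id[OF TpE LE] pL2 flip: whisker_left_whisker_right[OF phi D.MFun LE p])
    moreover have "p \<triangleright> (?D \<triangleright> \<phi>) = id_nat (MFun T \<circ>\<^sub>F MFun T \<circ>\<^sub>F p)"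
      using whisker_left_fcomp[OF phi D.MFun p T.MFun] whisker_left_id[OF TpE T.MFun]
      by (simp add: p_MFun pphi fcomp_assoc[OF p T.MFun] flip: whisker_left_fcomp[OF phi D.MFun D.MFun p])
    ultimately have "p \<triangleright> ?r = Mult T \<triangleleft> p"
      using vcomp_id_right[OF mTp TTp]
      by (simp add: whisker_left_vcomp[OF Dph mph D.TT_Fun p] whisker_left_vcomp[OF phL mL DL p] pmL)
    moreover have "p \<triangleright> ?l = Mult T \<triangleleft> p"
      by (simp add: whisker_left_vcomp[OF D.Mult phi D.TT_Fun p] pphi p_Mult vcomp_id_left[OF mTp TTp])
    ultimately show "p \<triangleright> ?l = p \<triangleright> ?r" by simp
    note m = codensity_mult_eq[OF Q(1) t(1,3)]
    note ml' = NatD[OF mL LL] and m' = NatD[OF m(1) fcomp_Fun[OF QE QE]]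
    note ty = D.typing FunD(4-10)[OF QE] l(4-10) ml'(2,3,5-7) m'(2,3,5-7) ph'(2,3,5-7) s'(2,3,5-7)
      NatD(2,3,5-7)[OF t(1) D.MFun]
    \<comment> \<open>The defining equation of \<open>Mult L\<close> introduces two copies of
      \<sigma>. Naturality of \<phi> at \<sigma> places each copy directly after a copy of \<phi>,
      and each pair merges into \<theta>; then \<theta> being a monad morphism finishes the
      comparison.\<close>
    have "\<sigma> \<bullet> ?r = ?m \<bullet> \<theta> \<triangleleft> Q \<bullet> ?D \<triangleright> \<theta>"
    proof (rule Nat_eqI[OF vcomp_Nat[OF r s D.TT_Fun] _ D.TT_Fun])
      show "?m \<bullet> \<theta> \<triangleleft> Q \<bullet> ?D \<triangleright> \<theta> \<in> Nat (?D \<circ>\<^sub>F ?D) Q"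
        unfolding m(2) by (rule vcomp_Nat[OF D.Mult t(1) D.TT_Fun])
      fix X assume X: "X \<in> Obj E"
      have sphi': "At \<sigma> Y \<cdot>\<^bsub>E\<^esub> At \<phi> Y = At \<theta> Y" if "Y \<in> Obj E" for Y
        using arg_cong[OF sphi, of "\<lambda>\<tau>. At \<tau> Y"] that by (simp add: ty)
      have "At \<sigma> X \<cdot>\<^bsub>E\<^esub> At (Mult L) X = At ?m X \<cdot>\<^bsub>E\<^esub> (At \<sigma> (ObM Q X) \<cdot>\<^bsub>E\<^esub> ArM ?L (At \<sigma> X))"
        using arg_cong[OF smL, of "\<lambda>\<tau>. At \<tau> X"] X by (simp add: ty D.C.comp_assoc)
      moreover have "At (\<sigma> \<bullet> ?r) X =
          (At \<sigma> X \<cdot>\<^bsub>E\<^esub> At (Mult L) X) \<cdot>\<^bsub>E\<^esub> (At \<phi> (ObM ?L X) \<cdot>\<^bsub>E\<^esub> ArM ?D (At \<phi> X))"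
        using X by (simp add: ty D.C.comp_assoc)
      ultimately have "At (\<sigma> \<bullet> ?r) X =
          (At ?m X \<cdot>\<^bsub>E\<^esub> (At \<sigma> (ObM Q X) \<cdot>\<^bsub>E\<^esub> ArM ?L (At \<sigma> X))) \<cdot>\<^bsub>E\<^esub> (At \<phi> (ObM ?L X) \<cdot>\<^bsub>E\<^esub> ArM ?D (At \<phi> X))"
        by simp
      also have "\<dots> = At ?m X \<cdot>\<^bsub>E\<^esub> (At \<sigma> (ObM Q X) \<cdot>\<^bsub>E\<^esub>
          ((ArM ?L (At \<sigma> X) \<cdot>\<^bsub>E\<^esub> At \<phi> (ObM ?L X)) \<cdot>\<^bsub>E\<^esub> ArM ?D (At \<phi> X)))"
        using X by (simp add: ty D.C.comp_assoc)
      also have "ArM ?L (At \<sigma> X) \<cdot>\<^bsub>E\<^esub> At \<phi> (ObM ?L X) = At \<phi> (ObM Q X) \<cdot>\<^bsub>E\<^esub> ArM ?D (At \<sigma> X)"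
        using X Nat_naturality[OF phi D.MFun s'(5)[OF X]] by (simp add: ty)
      also have "At ?m X \<cdot>\<^bsub>E\<^esub> (At \<sigma> (ObM Q X) \<cdot>\<^bsub>E\<^esub> (\<dots> \<cdot>\<^bsub>E\<^esub> ArM ?D (At \<phi> X))) =
          At ?m X \<cdot>\<^bsub>E\<^esub> ((At \<sigma> (ObM Q X) \<cdot>\<^bsub>E\<^esub> At \<phi> (ObM Q X)) \<cdot>\<^bsub>E\<^esub> ArM ?D (At \<sigma> X \<cdot>\<^bsub>E\<^esub> At \<phi> X))"
        using X by (simp add: D.MFunD(11) ty D.C.comp_assoc)
      also have "\<dots> = At (?m \<bullet> \<theta> \<triangleleft> Q \<bullet> ?D \<triangleright> \<theta>) X"
        using X by (simp add: sphi' ty D.C.comp_assoc)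
      finally show "At (\<sigma> \<bullet> ?r) X = At (?m \<bullet> \<theta> \<triangleleft> Q \<bullet> ?D \<triangleright> \<theta>) X" .
    qed
    then show "\<sigma> \<bullet> ?l = \<sigma> \<bullet> ?r"
      by (simp add: m(2) sphi flip: vcomp_assoc[OF D.Mult phi s D.TT_Fun])
  qed
  have "monad_on E L"
    by (rule D.monad_on_transport[OF LE uL mL phi psi phi_psi unit mult])
  then have "monad_lifting p T L"
    by (simp add: monad_lifting_def pD pL puL pmL)
  with lifting show ?thesis
    unfolding iso_liftings_def pD(4) using phi iso pphi unit mult by blast
qed

end

text \<open>Because the codensity lifting depends on choices, being isomorphic to it is rendered in
  two clauses: some codensity lifting exists, and every one is isomorphic to \<open>D\<close>. The
  first keeps the second from being vacuous.\<close>

theorem theorem3p7: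
  fixes E :: "('oe, 'me) cat" and B :: "('ob, 'mb) cat"
    and p :: "('oe, 'me, 'ob, 'mb) cfunctor"
    and T :: "('ob, 'mb) mnd" and D :: "('oe, 'me) mnd"
  assumes "p \<in> Fun E B" and "fibration p"
    and "monad_on B T"
    and "monad_lifting p T D"
  shows "\<exists>(A :: ('oe, 'me \<times> 'oe) cat)
           (R :: ('oe, 'me \<times> 'oe, 'ob, 'mb \<times> 'ob) cfunctor)
           (S :: ('oe, 'me \<times> 'oe, 'oe, 'me) cfunctor).
           lifting_parameter p T A R S \<and>
           codensity_condition p S \<and>
           (\<exists>L. codensity_lifting p T R S L) \<and>
           (\<forall>L. codensity_lifting p T R S L \<longrightarrow> iso_liftings p T D L)"
proof -
  note pD = FunD[OF assms(1)]
  have "monad_on E D" using assms(4) by (simp add: monad_lifting_def pD)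
  then interpret lifted_monad B T E D p
    using assms pD by (intro lifted_monad.intro monad.intro monad_axioms.intro lifted_monad_axioms.intro)
  have "lifting_parameter p T (kleisli D) R S"
    by (simp add: lifting_parameter_def kleisli_map_Fun S pD K_kleisli_map)
  moreover have "codensity_condition p S"
    unfolding codensity_condition_def using is_ran_S preserves_ran_S by blast
  ultimately show ?thesis
    using codensity_lifting_self codensity_lifting_iso by blast
qed

end
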